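(* Let $CP_3(n)$ be defined by $\sum_{n\ge 0} CP_3(n)q^n = \dfrac{f_3^6f_6^6}{f_1^2f_2^2}$. Then for all integers $n\ge 0$, \[ CP_3(8n+3)\equiv 0\pmod{8},\qquad CP_3(8n+7)\equiv 0\pmod{16}. \]
   Context: For $|q|<1$ and integer $m\ge 1$, $f_m := (q^m;q^m)_\infty=\prod_{n\ge1}(1-q^{mn})$. $CP_3(n)$ is the number of $3$-core cubic bipartitions of $n$, defined by the generating function $\sum_{n\ge0}CP_3(n)q^n = \frac{f_3^6f_6^6}{f_1^2f_2^2}$. *)

theory Defs
  imports
    "HOL-Analysis.Analysis"
    "HOL-Computational_Algebra.Formal_Power_Series"
    "HOL-Number_Theory.Cong"
begin

text \<open>
  The products and the generating function are read as formal power series in \<open>q\<close> with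
  integer coefficients.  The infinite product \<open>(q\<^sup>m; q\<^sup>m)\<^sub>\<infinity>\<close> is the limit of the partial
  products in the standard metric on formal power series; the library index starts at \<open>0\<close>,
  hence the \<open>Suc\<close>.
\<close>

definition qf :: "nat \<Rightarrow> int fps" where
  "qf m = (\<Prod>n. 1 - fps_X ^ (m * Suc n))"

text \<open>
  The type \<^typ>\<open>int fps\<close> has no \<open>/\<close>, because \<^typ>\<open>int\<close> has no \<open>inverse\<close>.  The quotient is
  therefore formed with \<^term>\<open>fps_right_inverse g 1\<close>, which is the multiplicative inverse of
  \<open>g\<close> when \<open>g\<close> has constant term \<open>1\<close>; see \<open>CP3_gf_mult\<close> below.
\<close>

definition CP3_gf :: "int fps" where
  "CP3_gf = (qf 3 ^ 6 * qf 6 ^ 6) * fps_right_inverse (qf 1 ^ 2 * qf 2 ^ 2) 1"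

definition CP3 :: "nat \<Rightarrow> int" where
  "CP3 n = fps_nth CP3_gf n"

lemma qf_partial_nth:
  assumes "m \<ge> 1" "k \<le> n"
  shows "fps_nth (\<Prod>i\<le>n. 1 - fps_X ^ (m * Suc i) :: int fps) k =
         fps_nth (\<Prod>i\<le>k. 1 - fps_X ^ (m * Suc i)) k"
  using assms(2)
proof (induction rule: dec_induct)
  case (step n)
  have "1 * Suc (Suc n) \<le> m * Suc (Suc n)"
    by (intro mult_le_mono1 assms(1))
  then have k: "k < m * Suc (Suc n)"
    using step.hyps(1) by (rule_tac order.strict_trans2[of k "Suc (Suc n)"]) simp_all
  have "fps_nth (\<Prod>i\<le>Suc n. 1 - fps_X ^ (m * Suc i) :: int fps) k =
        fps_nth ((\<Prod>i\<le>n. 1 - fps_X ^ (m * Suc i)) * (1 - fps_X ^ (m * Suc (Suc n)))) k"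
    by (simp only: prod.atMost_Suc)
  also have "\<dots> = fps_nth (\<Prod>i\<le>n. 1 - fps_X ^ (m * Suc i)) k"
    unfolding right_diff_distrib mult_1_right fps_sub_nth fps_X_power_mult_right_nth using k by simp
  finally show ?case
    using step.IH by simp
qed simp

lemma qf_has_prod:
  assumes "m \<ge> 1"
  shows "(\<lambda>n. 1 - fps_X ^ (m * Suc n)) has_prod qf m" and "fps_nth (qf m) 0 = 1"
proof -
  let ?F = "\<lambda>n. 1 - fps_X ^ (m * Suc n) :: int fps"
  define P where "P = Abs_fps (\<lambda>k. fps_nth (\<Prod>i\<le>k. ?F i) k)"
  have P0: "fps_nth P 0 = 1"
    using assms by (simp add: P_def)
  have "(\<lambda>n. \<Prod>i\<le>n. ?F i) \<longlonglongrightarrow> P"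
    unfolding tendsto_fps_iff eventually_sequentially P_def fps_nth_Abs_fps
    using qf_partial_nth[OF assms] by blast
  moreover have "P \<noteq> 0"
    using P0 by auto
  ultimately have *: "?F has_prod P"
    by (simp add: has_prod_def raw_has_prod_def)
  then have "qf m = P"
    unfolding qf_def by (rule has_prod_unique[symmetric])
  with * P0 show "?F has_prod qf m" "fps_nth (qf m) 0 = 1"
    by simp_all
qed

lemma CP3_gf_mult: "Abs_fps CP3 * (qf 1 ^ 2 * qf 2 ^ 2) = qf 3 ^ 6 * qf 6 ^ 6"
proof -
  have "fps_nth (qf 1 ^ 2 * qf 2 ^ 2) 0 = 1"
    by (simp add: qf_has_prod(2) fps_nth_power_0)
  then have "(qf 1 ^ 2 * qf 2 ^ 2) * fps_right_inverse (qf 1 ^ 2 * qf 2 ^ 2) 1 = 1"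
    by (intro fps_right_inverse) simp
  moreover have "Abs_fps CP3 = CP3_gf"
    by (simp add: fps_eq_iff CP3_def)
  ultimately show ?thesis
    by (simp only: CP3_gf_def mult.assoc mult.commute[of "fps_right_inverse _ _"] mult_1_right)
qed

end

theory Submission
  imports Defs
begin

text \<open>
  Write \<open>f\<^sub>m\<close> for \<^term>\<open>qf m\<close>, let \<open>\<phi>(q) = \<Sum>q\<^bsup>n\<^sup>2\<^esup>\<close> be summed over the integers, and let
  \<open>\<psi>(q) = \<Sum>q\<^bsup>n(n+1)/2\<^esup>\<close> be summed over the naturals, with \<open>\<psi>\<^sub>m = \<psi>(q\<^sup>m)\<close>.
  Gauss's identities \<open>\<phi>(-q) = f\<^sub>1\<^sup>2 / f\<^sub>2\<close> and \<open>\<psi>(q) = f\<^sub>2\<^sup>2 / f\<^sub>1\<close> turn the generating function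
  into \<open>K \<phi>(q) \<phi>(q\<^sup>3) \<phi>(-q\<^sup>3)\<^sup>4\<close>, where \<open>K\<close> is a series in \<open>q\<^sup>2\<close>, and \<open>\<phi>(-q\<^sup>3)\<^sup>4\<close> is
  congruent to \<open>1\<close> modulo \<open>8\<close>.  The map \<open>(x, y) \<mapsto> (x + 3y, x - y)\<close> shows that the odd part of
  \<open>\<phi>(q) \<phi>(q\<^sup>3)\<close> is \<open>2q \<psi>\<^sub>2 \<psi>\<^sub>6\<close>.  Reducing \<open>K \<psi>\<^sub>2 \<psi>\<^sub>6\<close> modulo \<open>8\<close> and \<open>K\<close> modulo \<open>2\<close>, the two
  contributions \<open>8q\<^sup>7 \<psi>\<^sub>2\<^sub>4 \<psi>\<^sub>4\<^sub>8\<close> add up to a multiple of \<open>16\<close>, and modulo \<open>16\<close> the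
  exponents congruent to \<open>3\<close> modulo \<open>4\<close> carry only \<open>8q\<^sup>3 \<psi>\<^sub>1\<^sub>6 \<psi>\<^sub>2\<^sub>4\<close>.
\<close>

section \<open>Shanks's finite forms of Gauss's identities\<close>

text \<open>The denominators of Shanks's identity are cleared, so it is polynomial and holds in any
  commutative ring. Every summand of the error sum on the right carries
  \<open>q ^ (Suc s * Suc n)\<close>, which vanishes in the limit.\<close>

lemma shanks_square_sum:
  fixes q :: "'a::comm_ring_1"
  shows "(1 + 2 * (\<Sum>s<n. (-1) ^ Suc s * q ^ (Suc s)\<^sup>2)) * (\<Prod>k\<in>{0<..n}. 1 + q ^ k) =
    (\<Prod>k\<in>{0<..n}. 1 - q ^ k) +
    2 * (\<Sum>s<n. (-1) ^ Suc s * q ^ (Suc s * Suc n) * (\<Prod>k\<in>{Suc s<..n}. 1 - q ^ k) * (\<Prod>k\<in>{0<..s}. 1 + q ^ k))"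
proof (induction n)
  case 0
  then show ?case by simp
next
  case (Suc n)
  define A where "A s m = (\<Prod>k\<in>{s<..m}. 1 - q ^ k)" for s m :: nat
  define D where "D s = (\<Prod>k\<in>{0<..s}. 1 + q ^ k)" for s :: nat
  define T where "T m s = (-1) ^ Suc s * q ^ (Suc s * Suc m) * A (Suc s) m * D s" for m s :: nat
  \<comment> \<open>\<open>V\<close> is the telescoping certificate: passing from level
    \<open>n\<close> to \<open>Suc n\<close> multiplies the summand by \<open>1 + q ^ Suc n\<close>
    up to the difference \<open>V s - V (Suc s)\<close>.\<close>
  define V where "V s = (-1) ^ s * q ^ (Suc s * Suc n) * A s n * D s" for s
  have A_top: "A s (Suc n) = A s n * (1 - q ^ Suc n)" if "s \<le> n" for s
  proof -
    have "{s<..Suc n} = insert (Suc n) {s<..n}" using that by auto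
    then show ?thesis by (simp add: A_def mult.commute)
  qed
  have A_bot: "A s n = (1 - q ^ Suc s) * A (Suc s) n" if "s < n" for s
  proof -
    have "{s<..n} = insert (Suc s) {Suc s<..n}" using that by auto
    then show ?thesis by (simp add: A_def)
  qed
  have D_Suc: "D (Suc s) = D s * (1 + q ^ Suc s)" for s
  proof -
    have "{0<..Suc s} = insert (Suc s) {0<..s}" by auto
    then show ?thesis by (simp add: D_def mult.commute)
  qed
  have A_self: "A s s = 1" for s by (simp add: A_def)
  have step: "T (Suc n) s = (1 + q ^ Suc n) * T n s + V s - V (Suc s)" if "s < n" for s
  proof -
    have *: "A (Suc s) (Suc n) = A (Suc s) n * (1 - q ^ Suc n)"
      using that by (intro A_top) simp
    show ?thesis
      unfolding T_def V_def * A_bot[OF that] D_Suc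
      by (simp add: algebra_simps power_add)
  qed
  have "(\<Sum>s<j. T (Suc n) s) = (1 + q ^ Suc n) * (\<Sum>s<j. T n s) + V 0 - V j" if "j \<le> n" for j
    using that by (induction j) (simp_all add: step algebra_simps)
  from this[of n] have tel: "(\<Sum>s<n. T (Suc n) s) = (1 + q ^ Suc n) * (\<Sum>s<n. T n s) + V 0 - V n"
    by simp
  have IH: "(1 + 2 * (\<Sum>s<n. (-1) ^ Suc s * q ^ (Suc s)\<^sup>2)) * D n = A 0 n + 2 * (\<Sum>s<n. T n s)"
    using Suc.IH unfolding A_def D_def T_def .
  \<comment> \<open>The boundary terms supply what the induction needs: \<open>2 * V 0\<close> turns
    \<open>A 0 n * (1 - q ^ Suc n)\<close> into \<open>A 0 n * (1 + q ^ Suc n)\<close>, and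
    \<open>T (Suc n) n - V n\<close> is the new term of the square sum times
    \<open>D (Suc n)\<close>.\<close>
  have V0: "V 0 = q ^ Suc n * A 0 n" by (simp add: V_def D_def)
  have Vn: "V n = - ((-1) ^ Suc n * q ^ (Suc n)\<^sup>2 * D n)"
    by (simp add: V_def A_self power2_eq_square)
  have Tn: "T (Suc n) n = (-1) ^ Suc n * q ^ (Suc n)\<^sup>2 * q ^ Suc n * D n"
    unfolding T_def A_self by (simp add: power2_eq_square power_add algebra_simps)
  define F where "F = (\<Sum>s<n. (-1) ^ Suc s * q ^ (Suc s)\<^sup>2)"
  define t where "t = (-1) ^ Suc n * q ^ (Suc n)\<^sup>2"
  have "(1 + 2 * (F + t)) * (D n * (1 + q ^ Suc n)) =
      (1 + 2 * F) * D n * (1 + q ^ Suc n) + 2 * t * D n * (1 + q ^ Suc n)"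
    by (simp add: algebra_simps)
  also have "\<dots> = A 0 n * (1 - q ^ Suc n) + 2 * ((\<Sum>s<n. T (Suc n) s) + T (Suc n) n)"
    unfolding IH[folded F_def] tel V0 Vn Tn t_def[symmetric] by (simp add: algebra_simps)
  finally show ?case
    unfolding T_def[symmetric] A_def[symmetric] D_def[symmetric] D_Suc A_top[OF le0]
      sum.lessThan_Suc F_def t_def .
qed

text \<open>The same telescoping, but each step of \<open>n\<close> adds two triangular exponents.
  On the right only the summand \<open>s = 0\<close> is free of the factor
  \<open>q ^ (2 * n + 1)\<close>, so it alone survives in the limit.\<close>

lemma shanks_triangular_sum:
  fixes q :: "'a::comm_ring_1"
  shows "(\<Sum>s<2 * n. q ^ (s * Suc s div 2)) * (\<Prod>k<n. 1 - q ^ (2 * k + 1)) =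
    (\<Sum>s<n. q ^ (s * (2 * n + 1)) * (\<Prod>k\<in>{s<..n}. 1 - q ^ (2 * k)) * (\<Prod>k<s. 1 - q ^ (2 * k + 1)))"
proof (induction n)
  case 0
  then show ?case by simp
next
  case (Suc n)
  define A where "A s m = (\<Prod>k\<in>{s<..m}. 1 - q ^ (2 * k))" for s m :: nat
  define D where "D s = (\<Prod>k<s. 1 - q ^ (2 * k + 1))" for s :: nat
  define T where "T m s = q ^ (s * (2 * m + 1)) * A s m * D s" for m s :: nat
  \<comment> \<open>\<open>V 0 = 0\<close>, so telescoping leaves only the upper boundary
    term.\<close>
  define V where "V s = (1 - q ^ (2 * s)) * T n s" for s
  have A_top: "A s (Suc n) = A s n * (1 - q ^ (2 * Suc n))" if "s \<le> n" for s
  proof -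
    have "{s<..Suc n} = insert (Suc n) {s<..n}" using that by auto
    then show ?thesis by (simp add: A_def mult.commute)
  qed
  have A_bot: "A s n = (1 - q ^ (2 * Suc s)) * A (Suc s) n" if "s < n" for s
  proof -
    have "{s<..n} = insert (Suc s) {Suc s<..n}" using that by auto
    then show ?thesis by (simp add: A_def)
  qed
  have D_Suc: "D (Suc s) = D s * (1 - q ^ (2 * s + 1))" for s
    by (simp add: D_def)
  have A_self: "A s s = 1" for s by (simp add: A_def)
  have step: "T (Suc n) s = (1 - q ^ (2 * n + 1)) * T n s + V (Suc s) - V s" if "s < n" for s
  proof -
    have V: "V (Suc s) = q ^ (Suc s * (2 * n + 1)) * A s n * D (Suc s)"
      unfolding V_def T_def A_bot[OF that] by (simp only: mult_ac)
    define u where "u = q ^ (s * (2 * n + 1))"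
    have e: "q ^ (s * (2 * Suc n + 1)) = u * q ^ (2 * s)"
      "q ^ (Suc s * (2 * n + 1)) = u * q ^ (2 * n + 1)"
      "q ^ (2 * Suc n) = q * q ^ (2 * n + 1)" "q ^ (2 * s + 1) = q * q ^ (2 * s)"
      by (simp_all add: u_def algebra_simps flip: power_add power_Suc)
    show ?thesis
      unfolding V unfolding T_def V_def A_top[OF less_imp_le[OF that]] D_Suc e u_def[symmetric]
      by (simp only: algebra_simps mult_1_left)
  qed
  have "(\<Sum>s<j. T (Suc n) s) = (1 - q ^ (2 * n + 1)) * (\<Sum>s<j. T n s) + V j" if "j \<le> n" for j
    using that
  proof (induction j)
    case 0
    then show ?case by (simp add: V_def)
  next
    case (Suc j)
    then show ?case by (simp add: step algebra_simps del: mult_Suc_right)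
  qed
  from this[of n] have tel: "(\<Sum>s<n. T (Suc n) s) = (1 - q ^ (2 * n + 1)) * (\<Sum>s<n. T n s) + V n"
    by simp
  have IH: "(\<Sum>s<2 * n. q ^ (s * Suc s div 2)) * D n = (\<Sum>s<n. T n s)"
    using Suc.IH unfolding A_def D_def T_def .
  define F where "F = (\<Sum>s<2 * n. q ^ (s * Suc s div 2))"
  have Tn: "T (Suc n) n = q ^ (n * (2 * n + 1)) * q ^ (2 * n) * (1 - q ^ (2 * Suc n)) * D n"
  proof -
    have e: "n * (2 * Suc n + 1) = n * (2 * n + 1) + 2 * n" by (simp add: algebra_simps)
    show ?thesis
      unfolding T_def A_top[OF order_refl] A_self e power_add[of q "n * (2 * n + 1)" "2 * n"]
      by (simp only: mult_ac mult_1_left)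
  qed
  have Vn: "V n = (1 - q ^ (2 * n)) * q ^ (n * (2 * n + 1)) * D n"
    unfolding V_def T_def A_self by simp
  have e1: "2 * n * Suc (2 * n) div 2 = n * (2 * n + 1)"
    by simp
  have "Suc (2 * n) * Suc (Suc (2 * n)) = 2 * (n * (2 * n + 1) + (2 * n + 1))"
    by (simp add: algebra_simps)
  then have e2: "Suc (2 * n) * Suc (Suc (2 * n)) div 2 = n * (2 * n + 1) + (2 * n + 1)"
    by presburger
  have "(F + q ^ (n * (2 * n + 1)) + q ^ (n * (2 * n + 1) + (2 * n + 1))) * (D n * (1 - q ^ (2 * n + 1))) =
     F * D n * (1 - q ^ (2 * n + 1)) +
     q ^ (n * (2 * n + 1)) * ((1 + q ^ (2 * n + 1)) * (1 - q ^ (2 * n + 1))) * D n"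
    unfolding power_add[of q "n * (2 * n + 1)" "2 * n + 1"] by (simp only: algebra_simps mult_1_left)
  \<comment> \<open>This splitting of \<open>1 - q ^ (4 * n + 2)\<close> separates the contribution
    of the two new exponents into exactly \<open>V n\<close> and \<open>T (Suc n) n\<close>.\<close>
  also have "(1 + q ^ (2 * n + 1)) * (1 - q ^ (2 * n + 1)) = (1 - q ^ (2 * n)) + q ^ (2 * n) * (1 - q ^ (2 * Suc n))"
    by (simp add: algebra_simps flip: power_add power_mult mult_2)
  also have "F * D n * (1 - q ^ (2 * n + 1)) +
     q ^ (n * (2 * n + 1)) * ((1 - q ^ (2 * n)) + q ^ (2 * n) * (1 - q ^ (2 * Suc n))) * D n =
     (\<Sum>s<n. T (Suc n) s) + T (Suc n) n"
    unfolding IH[folded F_def] tel Vn Tn by (simp only: algebra_simps mult_1_left)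
  finally have "(F + q ^ (n * (2 * n + 1)) + q ^ (n * (2 * n + 1) + (2 * n + 1))) * D (Suc n) =
      (\<Sum>s<Suc n. T (Suc n) s)"
    unfolding D_Suc by simp
  moreover have "(\<Sum>s<2 * Suc n. q ^ (s * Suc s div 2)) =
      F + q ^ (n * (2 * n + 1)) + q ^ (n * (2 * n + 1) + (2 * n + 1))"
  proof -
    have "2 * Suc n = Suc (Suc (2 * n))" by simp
    then show ?thesis unfolding F_def by (simp only: sum.lessThan_Suc e1 e2)
  qed
  ultimately show ?case
    unfolding T_def A_def D_def by simp
qed

section \<open>Counting series\<close>

text \<open>Encoding a series by the fibres of its exponent function turns identities between series
  into bijections. An infinite fibre counts as \<open>0\<close>, hence the finiteness assumptions
  for sums and products.\<close>

definition gf :: "('a \<Rightarrow> nat) \<Rightarrow> 'a set \<Rightarrow> int fps" where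
  "gf a A = Abs_fps (\<lambda>k. int (card {x \<in> A. a x = k}))"

lemma gf_nth: "fps_nth (gf a A) k = int (card {x \<in> A. a x = k})"
  by (simp add: gf_def)

lemma gf_reindex:
  assumes "bij_betw h A B" "\<And>x. x \<in> A \<Longrightarrow> b (h x) = a x"
  shows "gf b B = gf a A"
proof (rule fps_ext)
  fix k
  have "bij_betw h {x \<in> A. a x = k} {y \<in> B. b y = k}"
    using assms unfolding bij_betw_def inj_on_def by (auto simp: image_iff) 
  then show "fps_nth (gf b B) k = fps_nth (gf a A) k"
    by (simp add: gf_nth bij_betw_same_card)
qed

lemma gf_Un:
  assumes "A \<inter> B = {}" "\<And>k. finite {x \<in> A \<union> B. a x = k}"
  shows "gf a (A \<union> B) = gf a A + gf a B"
proof (rule fps_ext)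
  fix k
  have "{x \<in> A \<union> B. a x = k} = {x \<in> A. a x = k} \<union> {x \<in> B. a x = k}" by auto
  moreover have "finite {x \<in> A. a x = k}" "finite {x \<in> B. a x = k}"
    by (rule finite_subset[OF _ assms(2)[of k]], blast)+
  ultimately show "fps_nth (gf a (A \<union> B)) k = fps_nth (gf a A + gf a B) k"
    using assms(1) by (simp add: gf_nth) (subst card_Un_disjoint, auto)
qed

lemma gf_finite:
  assumes "finite A"
  shows "gf a A = (\<Sum>x\<in>A. fps_X ^ a x)"
proof (rule fps_ext)
  fix k
  have "card {x \<in> A. a x = k} = (\<Sum>x\<in>A. if a x = k then 1 else 0)"
    using assms by (simp add: sum.If_cases Int_def)
  then show "fps_nth (gf a A) k = fps_nth (\<Sum>x\<in>A. fps_X ^ a x) k"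
    by (auto simp: gf_nth fps_sum_nth fps_X_power_nth intro!: sum.cong)
qed

lemma gf_shift: "gf (\<lambda>x. a x + j) A = fps_X ^ j * gf a A"
proof (rule fps_ext)
  fix k
  show "fps_nth (gf (\<lambda>x. a x + j) A) k = fps_nth (fps_X ^ j * gf a A) k"
  proof (cases "k < j")
    case False
    then have "{x \<in> A. a x + j = k} = {x \<in> A. a x = k - j}" by auto
    with False show ?thesis by (simp add: gf_nth fps_X_power_mult_nth)
  qed (simp add: gf_nth fps_X_power_mult_nth)
qed

lemma gf_mult:
  assumes "\<And>k. finite {x \<in> A. a x = k}" "\<And>k. finite {y \<in> B. b y = k}"
  shows "gf a A * gf b B = gf (\<lambda>(x, y). a x + b y) (A \<times> B)"
proof (rule fps_ext)
  fix n
  have "{p \<in> A \<times> B. (case p of (x, y) \<Rightarrow> a x + b y) = n} =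
    (\<Union>i\<in>{0..n}. {x \<in> A. a x = i} \<times> {y \<in> B. b y = n - i})" (is "?L = ?R")
    by auto
  also have "card \<dots> = (\<Sum>i\<in>{0..n}. card ({x \<in> A. a x = i} \<times> {y \<in> B. b y = n - i}))"
    using assms by (intro card_UN_disjoint) auto
  finally show "fps_nth (gf a A * gf b B) n = fps_nth (gf (\<lambda>(x, y). a x + b y) (A \<times> B)) n"
    by (simp add: gf_nth fps_mult_nth card_cartesian_product)
qed

lemma fps_X_power_dvd_iff: "fps_X ^ n dvd f \<longleftrightarrow> (\<forall>k<n. fps_nth f k = 0)"
  for f :: "'a::comm_ring_1 fps"
proof
  assume "\<forall>k<n. fps_nth f k = 0"
  then have "f = fps_X ^ n * fps_shift n f"
    by (intro fps_ext) (auto simp: fps_X_power_mult_nth)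
  then show "fps_X ^ n dvd f" by (rule dvdI)
qed (auto simp: fps_X_power_mult_nth elim!: dvdE)

text \<open>This replaces passage to the limit: an infinite identity follows from its finite forms
  modulo every power of \<open>fps_X\<close>.\<close>

lemma fps_eqI_X_power_dvd:
  fixes f g :: "'a::comm_ring_1 fps"
  assumes "\<And>n. fps_X ^ n dvd f - g"
  shows "f = g"
proof (rule fps_ext)
  fix k
  show "fps_nth f k = fps_nth g k"
    using assms[of "Suc k"] unfolding fps_X_power_dvd_iff by auto
qed

lemma finite_fibre_nat:
  fixes a :: "nat \<Rightarrow> nat"
  assumes "\<And>s. s \<le> a s"
  shows "finite {s \<in> A. a s = k}"
  by (rule finite_subset[of _ "{..k}"]) (use assms in auto)

text \<open>By the bound on \<open>a\<close>, indices from \<open>n\<close> on contribute only in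
  degrees at least \<open>n\<close>.\<close>

lemma gf_truncate:
  fixes a :: "nat \<Rightarrow> nat"
  assumes "\<And>s. s \<le> a s"
  shows "fps_X ^ n dvd gf a UNIV - (\<Sum>s<n. fps_X ^ a s)"
proof -
  have "gf a UNIV = gf a ({..<n} \<union> {n..})"
    by (rule arg_cong[of _ _ "gf a"]) auto
  also have "\<dots> = gf a {..<n} + gf a {n..}"
    by (intro gf_Un finite_fibre_nat assms) auto
  finally have "gf a UNIV - (\<Sum>s<n. fps_X ^ a s) = gf a {n..}"
    by (simp add: gf_finite)
  moreover have "fps_X ^ n dvd gf a {n..}"
    unfolding fps_X_power_dvd_iff gf_nth
  proof (intro allI impI)
    fix k assume "k < n"
    have "{s \<in> {n..}. a s = k} = {}"
    proof safe
      fix s assume "n \<le> s" "k = a s"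
      with assms[of s] \<open>k < n\<close> show "s \<in> {}" by simp
    qed
    then show "int (card {s \<in> {n..}. a s = k}) = 0" by (simp only: card.empty of_nat_0)
  qed
  ultimately show ?thesis by simp
qed

section \<open>Congruences in a ring\<close>

text \<open>The modulus is an arbitrary ring element because two kinds occur: powers of
  \<open>fps_X\<close> for truncation, and the integers 2, 8 and 16.\<close>

definition rcong :: "'a::comm_ring_1 \<Rightarrow> 'a \<Rightarrow> 'a \<Rightarrow> bool" where
  "rcong m a b \<longleftrightarrow> m dvd a - b"

lemma rcong_refl [simp, intro]: "rcong m a a"
  by (simp add: rcong_def)

lemma rcong_sym: "rcong m a b \<Longrightarrow> rcong m b a"
  by (metis rcong_def dvd_minus_iff minus_diff_eq)

lemma rcong_trans [trans]: "rcong m a b \<Longrightarrow> rcong m b c \<Longrightarrow> rcong m a c"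
  unfolding rcong_def by (drule (1) dvd_add) simp

lemma rcong_add: "rcong m a b \<Longrightarrow> rcong m c d \<Longrightarrow> rcong m (a + c) (b + d)"
  unfolding rcong_def by (drule (1) dvd_add) (simp add: algebra_simps)

lemma rcong_diff: "rcong m a b \<Longrightarrow> rcong m c d \<Longrightarrow> rcong m (a - c) (b - d)"
  unfolding rcong_def by (drule (1) dvd_diff) (simp add: algebra_simps)

lemma rcong_mult:
  assumes "rcong m a b" "rcong m c d"
  shows "rcong m (a * c) (b * d)"
proof -
  have "a * c - b * d = (a - b) * c + b * (c - d)" by (simp add: algebra_simps)
  with assms show ?thesis by (simp add: rcong_def)
qed

lemma rcong_power: "rcong m a b \<Longrightarrow> rcong m (a ^ n) (b ^ n)"
  by (induction n) (simp_all add: rcong_mult)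

lemma rcong_scale: "rcong m a b \<Longrightarrow> rcong (c * m) (c * a) (c * b)"
  unfolding rcong_def by (simp flip: right_diff_distrib) (rule mult_dvd_mono, simp_all)

lemma rcong_modulus: "rcong m a b \<Longrightarrow> k dvd m \<Longrightarrow> rcong k a b"
  unfolding rcong_def by (rule dvd_trans)

lemma rcong_cancel:
  assumes "rcong m (u * a) (u * b)" "u dvd 1"
  shows "rcong m a b"
proof -
  from assms(2) obtain h where h: "1 = u * h" by (rule dvdE)
  have "a - b = (u * h) * (a - b)" by (simp flip: h)
  also have "\<dots> = h * (u * a - u * b)" by (simp add: algebra_simps)
  finally show ?thesis using assms(1) by (simp add: rcong_def)
qed

section \<open>Theta series and Gauss's identities\<close>

text \<open>Only positive integers are summed over (hence \<open>Suc s\<close>), so that \<phi>(q^m)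
  is \<open>1 + 2 * theta_sq m\<close>.\<close>

definition theta_sq :: "nat \<Rightarrow> int fps" where
  "theta_sq m = gf (\<lambda>s. m * (Suc s)\<^sup>2) UNIV"

definition theta_tri :: "nat \<Rightarrow> int fps" where
  "theta_tri m = gf (\<lambda>s. m * (s * Suc s div 2)) UNIV"

text \<open>
  This is the series of the terms \<open>(-1)\<^sup>n q\<^bsup>mn\<^sup>2\<^esup>\<close> with \<open>n \<ge> 1\<close>: the even \<open>n\<close> give \<open>theta_sq (4 * m)\<close>, and
  the odd \<open>n\<close> give triangular exponents because \<open>(2s + 1)\<^sup>2 = 8 s(s + 1)/2 + 1\<close>.
\<close>
definition theta_alt :: "nat \<Rightarrow> int fps" where
  "theta_alt m = theta_sq (4 * m) - fps_X ^ m * theta_tri (8 * m)"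

lemma le_mult_square: "m \<ge> 1 \<Longrightarrow> s \<le> m * (Suc s)\<^sup>2"
proof -
  assume "m \<ge> 1"
  have "s \<le> (Suc s)\<^sup>2" by (simp add: power2_eq_square)
  also have "\<dots> \<le> m * (Suc s)\<^sup>2" using \<open>m \<ge> 1\<close> by simp
  finally show ?thesis .
qed

lemma le_mult_triangle: "m \<ge> 1 \<Longrightarrow> s \<le> m * (s * Suc s div 2)"
proof -
  assume "m \<ge> 1"
  have "s \<le> s * Suc s div 2" by (cases s) (simp_all add: less_eq_div_iff_mult_less_eq)
  also have "\<dots> \<le> m * (s * Suc s div 2)" using \<open>m \<ge> 1\<close> by simp
  finally show ?thesis .
qed

lemma eight_triangle: "8 * m * (s * Suc s div 2) + m = m * (Suc (2 * s))\<^sup>2"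
proof -
  have "8 * m * t = 4 * m * (2 * t)" for t :: nat by simp
  note this[of "s * Suc s div 2"]
  also have "2 * (s * Suc s div 2) = s * Suc s" by simp
  finally have "8 * m * (s * Suc s div 2) = 4 * m * (s * Suc s)" .
  then show ?thesis by (simp add: power2_eq_square algebra_simps)
qed

lemma theta_tri_shift: "fps_X ^ m * theta_tri (8 * m) = gf (\<lambda>s. m * (Suc (2 * s))\<^sup>2) UNIV"
  unfolding theta_tri_def gf_shift[symmetric] eight_triangle ..

text \<open>The sum is split by the parity of the number being squared. That number is
  \<open>Suc s\<close>, so even \<open>s\<close> gives the odd squares, which become shifted
  triangular exponents.\<close>

lemma theta_sq_dissection:
  assumes "m \<ge> 1"
  shows "theta_sq m = fps_X ^ m * theta_tri (8 * m) + theta_sq (4 * m)"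
proof -
  let ?a = "\<lambda>s. m * (Suc s)\<^sup>2"
  have "theta_sq m = gf ?a ({s. even s} \<union> {s. odd s})"
    unfolding theta_sq_def by (rule arg_cong[of _ _ "gf ?a"]) auto
  also have "\<dots> = gf ?a {s. even s} + gf ?a {s. odd s}"
    by (intro gf_Un finite_fibre_nat le_mult_square assms) auto
  also have "gf ?a {s. even s} = gf (\<lambda>s. m * (Suc (2 * s))\<^sup>2) UNIV"
  proof (rule gf_reindex[of "\<lambda>s. 2 * s"])
    show "bij_betw (\<lambda>s. 2 * s) UNIV {s::nat. even s}"
      by (rule bij_betw_byWitness[of _ "\<lambda>s. s div 2"]) auto
  qed simp
  also have "gf ?a {s. odd s} = gf (\<lambda>s. 4 * m * (Suc s)\<^sup>2) UNIV"
  proof (rule gf_reindex[of "\<lambda>s. 2 * s + 1"])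
    show "bij_betw (\<lambda>s. 2 * s + 1) UNIV {s::nat. odd s}"
      by (rule bij_betw_byWitness[of _ "\<lambda>s. s div 2"]) auto
  qed (simp add: power2_eq_square algebra_simps)
  finally show ?thesis
    unfolding theta_tri_shift theta_sq_def .
qed

lemma qf_truncate:
  assumes "m \<ge> 1" "n \<le> N"
  shows "rcong (fps_X ^ n) (qf m) (\<Prod>k\<in>{0<..N}. 1 - (fps_X ^ m) ^ k)"
proof (cases N)
  \<comment> \<open>Here \<open>n = 0\<close> as well, and the modulus is \<open>1\<close>.\<close>
  case 0
  with assms(2) show ?thesis by (simp add: rcong_def)
next
  case (Suc M)
  let ?F = "\<lambda>i. 1 - fps_X ^ (m * Suc i) :: int fps"
  have "(\<lambda>n. \<Prod>i\<le>n. ?F i) \<longlonglongrightarrow> qf m"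
  proof -
    \<comment> \<open>A non-zero value excludes the clause of \<open>has_prod\<close> that allows
      vanishing factors, leaving plain convergence of the partial products.\<close>
    have "qf m \<noteq> 0" using qf_has_prod(2)[OF assms(1)] by auto
    then show ?thesis
      using qf_has_prod(1)[OF assms(1)] by (simp add: has_prod_def raw_has_prod_def)
  qed
  then have lim: "\<exists>N0. \<forall>j\<ge>N0. fps_nth (\<Prod>i\<le>j. ?F i) k = fps_nth (qf m) k" for k
    by (simp add: tendsto_fps_iff eventually_sequentially)
  have "fps_nth (qf m) k = fps_nth (\<Prod>i\<le>M. ?F i) k" if "k < n" for k
  proof -
    obtain N0 where N0: "\<And>j. j \<ge> N0 \<Longrightarrow> fps_nth (\<Prod>i\<le>j. ?F i) k = fps_nth (qf m) k"
      using lim by blast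
    have "k \<le> M" using that assms(2) Suc by simp
    then show ?thesis
      using N0[of "max N0 k"] qf_partial_nth[OF assms(1), of k "max N0 k"] qf_partial_nth[OF assms(1), of k M]
      by simp
  qed
  moreover have "(\<Prod>k\<in>{0<..N}. 1 - (fps_X ^ m) ^ k :: int fps) = (\<Prod>i\<le>M. ?F i)"
    unfolding Suc
    by (rule prod.reindex_bij_witness[of _ Suc "\<lambda>k. k - 1"]) (auto simp flip: power_mult)
  ultimately show ?thesis
    by (simp add: rcong_def fps_X_power_dvd_iff)
qed

lemma sum_lessThan_even_odd:
  "(\<Sum>s<2 * n. f s) = (\<Sum>s<n. f (2 * s)) + (\<Sum>s<n. f (2 * s + 1))"
  for f :: "nat \<Rightarrow> 'a::comm_monoid_add"
  by (induction n) (simp_all add: algebra_simps)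

text \<open>Interleaving \<open>n\<close> terms of each half produces the alternating sum of length
  \<open>2 * n\<close> required by \<open>shanks_square_sum\<close>.\<close>

lemma theta_alt_truncate:
  assumes "m \<ge> 1"
  shows "rcong (fps_X ^ n) (theta_alt m) (\<Sum>s<2 * n. (-1) ^ Suc s * (fps_X ^ m) ^ (Suc s)\<^sup>2)"
proof -
  have "rcong (fps_X ^ n) (theta_sq (4 * m)) (\<Sum>s<n. fps_X ^ (4 * m * (Suc s)\<^sup>2))"
    unfolding theta_sq_def rcong_def using assms by (intro gf_truncate le_mult_square) simp
  moreover have "rcong (fps_X ^ n) (fps_X ^ m * theta_tri (8 * m)) (\<Sum>s<n. fps_X ^ (m * (Suc (2 * s))\<^sup>2))"
    unfolding theta_tri_shift rcong_def
  proof (rule gf_truncate)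
    show "s \<le> m * (Suc (2 * s))\<^sup>2" for s
      using le_mult_square[OF assms, of "2 * s"] by simp
  qed
  ultimately have "rcong (fps_X ^ n) (theta_alt m)
      ((\<Sum>s<n. fps_X ^ (4 * m * (Suc s)\<^sup>2)) - (\<Sum>s<n. fps_X ^ (m * (Suc (2 * s))\<^sup>2)))"
    unfolding theta_alt_def by (rule rcong_diff)
  also have "\<dots> = (\<Sum>s<2 * n. (-1) ^ Suc s * (fps_X ^ m) ^ (Suc s)\<^sup>2)"
  proof -
    have "4 * m * (Suc s)\<^sup>2 = m * (Suc (2 * s + 1))\<^sup>2" for s
      by (simp add: power2_eq_square algebra_simps)
    note e = this
    show ?thesis
      unfolding sum_lessThan_even_odd e by (simp add: sum_negf flip: power_mult)
  qed
  finally show ?thesis .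
qed

text \<open>Modulo \<open>fps_X ^ n\<close>, Shanks's identity reduces to \<open>F * D = A\<close>.
  Since \<open>D * A\<close> is the product for \<open>qf (2 * m)\<close>, multiplying by
  \<open>A\<close> gives the claim.\<close>

lemma gauss_square:
  assumes "m \<ge> 1"
  shows "(1 + 2 * theta_alt m) * qf (2 * m) = (qf m)\<^sup>2"
proof (rule fps_eqI_X_power_dvd, fold rcong_def)
  fix n
  let ?c = "rcong (fps_X ^ n :: int fps)"
  define q :: "int fps" where "q = fps_X ^ m"
  define F where "F = 1 + 2 * (\<Sum>s<2 * n. (-1) ^ Suc s * q ^ (Suc s)\<^sup>2)"
  define A where "A = (\<Prod>k\<in>{0<..2 * n}. 1 - q ^ k)"
  define D where "D = (\<Prod>k\<in>{0<..2 * n}. 1 + q ^ k)"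
  define R where "R = (\<Sum>s<2 * n. (-1) ^ Suc s * q ^ (Suc s * Suc (2 * n)) *
    (\<Prod>k\<in>{Suc s<..2 * n}. 1 - q ^ k) * (\<Prod>k\<in>{0<..s}. 1 + q ^ k))"
  have F: "?c (1 + 2 * theta_alt m) F"
    unfolding F_def q_def by (intro rcong_add rcong_mult rcong_refl theta_alt_truncate assms)
  have A: "?c (qf m) A"
    unfolding A_def q_def using assms by (intro qf_truncate) simp_all
  have "D * A = (\<Prod>k\<in>{0<..2 * n}. 1 - (fps_X ^ (2 * m)) ^ k)"
    unfolding D_def A_def prod.distrib[symmetric] q_def
    by (intro prod.cong refl) (simp add: algebra_simps flip: power_mult power_add mult_2_right)
  then have DA: "?c (qf (2 * m)) (D * A)"
    using assms qf_truncate[of "2 * m" n "2 * n"] by simp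
  have "fps_X ^ n dvd q ^ (Suc s * Suc (2 * n))" for s
  proof -
    have "1 * (1 * n) \<le> m * (Suc s * Suc (2 * n))" using assms by (intro mult_le_mono) simp_all
    then show ?thesis unfolding q_def power_mult[symmetric] by (intro le_imp_power_dvd) simp
  qed
  then have "fps_X ^ n dvd R"
    unfolding R_def by (intro dvd_sum dvd_mult2 dvd_mult) simp
  moreover have "F * D = A + 2 * R"
    unfolding F_def D_def A_def R_def by (rule shanks_square_sum)
  ultimately have FD: "?c (F * D) A"
    by (simp add: rcong_def)
  have "?c ((1 + 2 * theta_alt m) * qf (2 * m)) (F * (D * A))"
    by (intro rcong_mult F DA)
  also have "F * (D * A) = (F * D) * A" by (simp only: mult.assoc)
  also have "?c \<dots> (A * A)" by (intro rcong_mult FD rcong_refl)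
  also have "?c \<dots> (qf m * qf m)" by (intro rcong_mult rcong_sym[OF A])
  finally show "?c ((1 + 2 * theta_alt m) * qf (2 * m)) ((qf m)\<^sup>2)"
    by (simp add: power2_eq_square)
qed

text \<open>Modulo \<open>fps_X ^ n\<close>, Shanks's identity reduces to
  \<open>F * D N = E 0\<close>, where \<open>D N\<close> holds the odd factors and
  \<open>E 0\<close> the even ones. Multiplying by \<open>E 0\<close> gives the claim.\<close>

lemma gauss_triangular:
  assumes "m \<ge> 1"
  shows "theta_tri m * qf m = (qf (2 * m))\<^sup>2"
proof (rule fps_eqI_X_power_dvd, fold rcong_def)
  fix n
  let ?c = "rcong (fps_X ^ n :: int fps)"
  define q :: "int fps" where "q = fps_X ^ m"
  \<comment> \<open>A positive number of terms guarantees that the surviving summand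
    \<open>s = 0\<close> is present.\<close>
  define N where "N = Suc n"
  define F where "F = (\<Sum>s<2 * N. q ^ (s * Suc s div 2))"
  define E where "E s = (\<Prod>k\<in>{s<..N}. 1 - q ^ (2 * k))" for s
  define D where "D s = (\<Prod>k<s. 1 - q ^ (2 * k + 1))" for s
  define R where "R = (\<Sum>s<n. q ^ (Suc s * (2 * N + 1)) * E (Suc s) * D (Suc s))"
  have "rcong (fps_X ^ (2 * N)) (theta_tri m) F"
    unfolding F_def q_def theta_tri_def rcong_def power_mult[symmetric]
    by (intro gf_truncate le_mult_triangle assms)
  then have F: "?c (theta_tri m) F"
    by (rule rcong_modulus) (simp add: N_def le_imp_power_dvd)
  have "E 0 = (\<Prod>k\<in>{0<..N}. 1 - (fps_X ^ (2 * m)) ^ k)"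
    unfolding E_def q_def by (intro prod.cong refl) (simp add: ac_simps flip: power_mult)
  then have E: "?c (qf (2 * m)) (E 0)"
    using assms qf_truncate[of "2 * m" n N] by (simp add: N_def)
  have "D j * (\<Prod>k\<in>{0<..j}. 1 - q ^ (2 * k)) = (\<Prod>k\<in>{0<..2 * j}. 1 - q ^ k)" for j
  proof (induction j)
    case (Suc j)
    have 1: "{0<..2 * Suc j} = insert (2 * Suc j) (insert (2 * j + 1) {0<..2 * j})"
      and 2: "{0<..Suc j} = insert (Suc j) {0<..j}" by auto
    show ?case
      unfolding 1 2 using Suc[symmetric] by (simp add: D_def mult_ac)
  qed (simp add: D_def)
  then have DE: "?c (qf m) (D N * E 0)"
    using assms qf_truncate[of m n "2 * N"] by (simp add: E_def N_def q_def)
  have "fps_X ^ n dvd q ^ (Suc s * (2 * N + 1))" for s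
  proof -
    have "1 * (1 * n) \<le> m * (Suc s * (2 * N + 1))"
      using assms by (intro mult_le_mono) (simp_all add: N_def)
    then show ?thesis unfolding q_def power_mult[symmetric] by (intro le_imp_power_dvd) simp
  qed
  then have R: "fps_X ^ n dvd R"
    unfolding R_def by (intro dvd_sum dvd_mult2) simp
  have "F * D N = (\<Sum>s<N. q ^ (s * (2 * N + 1)) * E s * D s)"
    unfolding F_def D_def E_def by (rule shanks_triangular_sum)
  also have "\<dots> = (\<Sum>s<Suc n. q ^ (s * (2 * N + 1)) * E s * D s)"
    by (rule sum.cong) (simp_all add: N_def)
  also have "\<dots> = E 0 + R"
    unfolding sum.lessThan_Suc_shift R_def by (simp add: D_def)
  finally have "F * D N = E 0 + R" .
  with R have FD: "?c (F * D N) (E 0)"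
    by (simp add: rcong_def)
  have "?c (theta_tri m * qf m) (F * (D N * E 0))"
    by (intro rcong_mult F DE)
  also have "F * (D N * E 0) = (F * D N) * E 0" by (simp only: mult.assoc)
  also have "?c \<dots> (E 0 * E 0)" by (intro rcong_mult FD rcong_refl)
  also have "?c \<dots> (qf (2 * m) * qf (2 * m))" by (intro rcong_mult rcong_sym[OF E])
  finally show "?c (theta_tri m * qf m) ((qf (2 * m))\<^sup>2)"
    by (simp add: power2_eq_square)
qed

section \<open>The odd part of a product of two theta series\<close>

lemma finite_fibre_int_square:
  assumes "m \<ge> 1"
  shows "finite {x \<in> A. m * nat (x\<^sup>2) = k}"
proof (rule finite_subset)
  show "{x \<in> A. m * nat (x\<^sup>2) = k} \<subseteq> {- int k..int k}"
  proof
    fix x assume "x \<in> {x \<in> A. m * nat (x\<^sup>2) = k}"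
    then have "int m * x\<^sup>2 = int k" by auto
    moreover have "1 * x\<^sup>2 \<le> int m * x\<^sup>2" using assms by (intro mult_right_mono) auto
    moreover have "\<bar>x\<bar> \<le> x\<^sup>2"
      using self_le_power[of "\<bar>x\<bar>" 2] by (cases "x = 0") auto
    ultimately have "\<bar>x\<bar> \<le> int k" by linarith
    then show "x \<in> {- int k..int k}" by auto
  qed
qed simp

lemma gf_int_square:
  assumes "m \<ge> 1"
  shows "gf (\<lambda>x::int. m * nat (x\<^sup>2)) UNIV = 1 + 2 * theta_sq m"
proof -
  let ?a = "\<lambda>x::int. m * nat (x\<^sup>2)"
  note fin = finite_fibre_int_square[OF assms]
  have "gf ?a UNIV = gf ?a ({0} \<union> ({0<..} \<union> {..<0}))"
    by (rule arg_cong[of _ _ "gf ?a"]) auto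
  also have "\<dots> = gf ?a {0} + gf ?a ({0<..} \<union> {..<0})"
    by (rule gf_Un[OF _ fin]) auto
  also have "gf ?a ({0<..} \<union> {..<0}) = gf ?a {0<..} + gf ?a {..<0}"
    by (rule gf_Un[OF _ fin]) auto
  also have "gf ?a {0} = 1"
    by (simp add: gf_finite)
  also have "gf ?a {0<..} = theta_sq m"
    unfolding theta_sq_def
  proof (rule gf_reindex)
    show "bij_betw (\<lambda>s. int (Suc s)) UNIV {0<..}"
      by (rule bij_betw_byWitness[of _ "\<lambda>x. nat x - 1"]) auto
  qed (simp only: nat_power_eq of_nat_0_le_iff nat_int)
  also have "gf ?a {..<0} = theta_sq m"
    unfolding theta_sq_def
  proof (rule gf_reindex)
    show "bij_betw (\<lambda>s. - int (Suc s)) UNIV {..<0}"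
      by (rule bij_betw_byWitness[of _ "\<lambda>x. nat (- x) - 1"]) auto
  qed (simp only: power2_minus nat_power_eq of_nat_0_le_iff nat_int)
  finally show ?thesis by simp
qed

text \<open>Put u = x + 3y and v = x - y, so that u^2 + 3v^2 = 4n. For odd n both u and v are odd,
  with absolute values 2s + 1 and 2t + 1. The sign of u is free, while that of v is forced by u - v
  being divisible by 4; this explains the factor 2 and the Boolean component of
  \<open>f\<close>.\<close>

lemma card_square_plus_three_square:
  assumes "odd n"
  shows "card {(x :: int, y). x\<^sup>2 + 3 * y\<^sup>2 = int n} =
    2 * card {(s :: nat, t). s * Suc s + 3 * (t * Suc t) + 1 = n}"
    (is "card ?R = 2 * card ?S")
proof -
  define f where "f = (\<lambda>(x :: int, y).
    ((nat ((\<bar>x + 3 * y\<bar> - 1) div 2), nat ((\<bar>x - y\<bar> - 1) div 2)), 0 < x + 3 * y))"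
  have quad: "(x + 3 * y)\<^sup>2 + 3 * (x - y)\<^sup>2 = 4 * (x\<^sup>2 + 3 * y\<^sup>2)" for x y :: int
    by (simp add: power2_eq_square algebra_simps)
  have nat_form: "s * Suc s + 3 * (t * Suc t) + 1 = n \<longleftrightarrow>
    (2 * int s + 1)\<^sup>2 + 3 * (2 * int t + 1)\<^sup>2 = 4 * int n" for s t
  proof -
    have "(2 * int s + 1)\<^sup>2 + 3 * (2 * int t + 1)\<^sup>2 = 4 * int (s * Suc s + 3 * (t * Suc t) + 1)"
      by (simp add: power2_eq_square algebra_simps)
    then show ?thesis
      by (simp only: mult_cancel_left of_nat_eq_iff zero_neq_numeral numeral_neq_zero simp_thms)
  qed
  have odd_R: "odd (x + 3 * y) \<and> odd (x - y)" if "(x, y) \<in> ?R" for x y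
  proof -
    from that have "odd (x\<^sup>2 + 3 * y\<^sup>2)" using assms by simp
    then show ?thesis by simp
  qed
  have half: "2 * int (nat ((\<bar>z\<bar> - 1) div 2)) + 1 = \<bar>z\<bar>" if "odd z" for z :: int
  proof -
    have "z \<noteq> 0" using that by auto
    then have "0 \<le> (\<bar>z\<bar> - 1) div 2" by (simp add: pos_imp_zdiv_nonneg_iff)
    moreover have "2 * ((\<bar>z\<bar> - 1) div 2) + 1 = \<bar>z\<bar>" using that by presburger
    ultimately show ?thesis by simp
  qed
  have "bij_betw f ?R (?S \<times> UNIV)"
    unfolding bij_betw_def
  proof (intro conjI equalityI subsetI)
    show "inj_on f ?R"
    proof (intro inj_onI, clarify)
      fix x y x' y' :: int
      assume R: "x\<^sup>2 + 3 * y\<^sup>2 = int n" "x'\<^sup>2 + 3 * y'\<^sup>2 = int n" and eq: "f (x, y) = f (x', y')"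
      have o: "odd (x + 3 * y)" "odd (x - y)" "odd (x' + 3 * y')" "odd (x' - y')"
        using odd_R[of x y] odd_R[of x' y'] R by auto
      have e: "nat ((\<bar>x + 3 * y\<bar> - 1) div 2) = nat ((\<bar>x' + 3 * y'\<bar> - 1) div 2)"
        "nat ((\<bar>x - y\<bar> - 1) div 2) = nat ((\<bar>x' - y'\<bar> - 1) div 2)"
        "0 < x + 3 * y \<longleftrightarrow> 0 < x' + 3 * y'"
        using eq unfolding f_def prod.case prod.inject by blast+
      have abs: "\<bar>x + 3 * y\<bar> = \<bar>x' + 3 * y'\<bar>" "\<bar>x - y\<bar> = \<bar>x' - y'\<bar>"
        by (metis half o(1,3) e(1), metis half o(2,4) e(2))
      have same_sign: "a = b" if "\<bar>a\<bar> = \<bar>b\<bar>" "0 < a \<longleftrightarrow> 0 < b" for a b :: int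
        using that by (auto simp: abs_if split: if_splits)
      have u: "x + 3 * y = x' + 3 * y'"
        using same_sign abs(1) e(3) .
      from abs(2) consider "x - y = x' - y'" | "x - y = - (x' - y')"
        by (auto simp: abs_eq_iff)
      then show "x = x' \<and> y = y'"
      proof cases
        case 1
        with u show ?thesis by simp
      next
        case 2
        \<comment> \<open>A change of sign in \<open>x - y\<close> alone would make
          \<open>x' + 3 * y'\<close> even.\<close>
        with u have "x' + 3 * y' = 2 * (y + y')" by presburger
        with o(3) show ?thesis by simp
      qed
    qed
  next
    fix p assume "p \<in> f ` ?R"
    then obtain x y where R: "(x, y) \<in> ?R" and p: "p = f (x, y)" by auto
    define s where "s = nat ((\<bar>x + 3 * y\<bar> - 1) div 2)"
    define t where "t = nat ((\<bar>x - y\<bar> - 1) div 2)"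
    have st: "2 * int s + 1 = \<bar>x + 3 * y\<bar>" "2 * int t + 1 = \<bar>x - y\<bar>"
      unfolding s_def t_def using odd_R[OF R] half by blast+
    have "(2 * int s + 1)\<^sup>2 + 3 * (2 * int t + 1)\<^sup>2 = 4 * int n"
      using R quad[of x y] by (simp add: st)
    then have "(s, t) \<in> ?S"
      using nat_form by blast
    then show "p \<in> ?S \<times> UNIV"
      unfolding p f_def prod.case s_def[symmetric] t_def[symmetric] by blast
  next
    fix p assume "p \<in> ?S \<times> (UNIV :: bool set)"
    then obtain s t e where p: "p = ((s, t), e)" and S: "s * Suc s + 3 * (t * Suc t) + 1 = n" by auto
    define u where "u = (if e then 2 * int s + 1 else - (2 * int s + 1))"
    \<comment> \<open>For odd \<open>u\<close>, exactly one of the two signs makes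
      \<open>u - v\<close> divisible by 4, and then \<open>x\<close> and \<open>y\<close> are
      integers.\<close>
    define v where "v = (if 4 dvd u - (2 * int t + 1) then 2 * int t + 1 else - (2 * int t + 1))"
    have "4 dvd u - v"
      unfolding v_def u_def by (cases e; simp; presburger)
    then obtain y where y: "u - v = 4 * y" by (rule dvdE)
    define x where "x = u - 3 * y"
    have uv: "x + 3 * y = u" "x - y = v" using y by (simp_all add: x_def)
    have abs: "\<bar>u\<bar> = 2 * int s + 1" "\<bar>v\<bar> = 2 * int t + 1" by (simp_all add: u_def v_def)
    have "4 * (x\<^sup>2 + 3 * y\<^sup>2) = \<bar>u\<bar>\<^sup>2 + 3 * \<bar>v\<bar>\<^sup>2"
      unfolding quad[symmetric] uv by simp
    also have "\<dots> = 4 * int n"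
      unfolding abs using S nat_form by blast
    finally have "(x, y) \<in> ?R" by simp
    moreover have "f (x, y) = p"
      unfolding f_def p by (simp add: uv abs) (simp add: u_def)
    ultimately show "p \<in> f ` ?R" by (metis imageI)
  qed
  then have "card ?R = card (?S \<times> (UNIV :: bool set))"
    by (rule bij_betw_same_card)
  then show ?thesis
    by (simp add: card_cartesian_product)
qed

text \<open>Both coefficients count solutions: integer pairs on the left, and on the right pairs of
  naturals whose doubled triangular exponents need no division.\<close>

lemma theta_product_odd_nth:
  assumes "odd n"
  shows "fps_nth ((1 + 2 * theta_sq 1) * (1 + 2 * theta_sq 3)) n =
    fps_nth (2 * (fps_X * (theta_tri 2 * theta_tri 6))) n"
proof -
  have "(1 + 2 * theta_sq 1) * (1 + 2 * theta_sq 3) =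
      gf (\<lambda>(x, y). 1 * nat (x\<^sup>2) + 3 * nat (y\<^sup>2)) (UNIV \<times> UNIV)"
    unfolding gf_int_square[OF order_refl, symmetric] gf_int_square[of 3, simplified, symmetric]
    by (intro gf_mult finite_fibre_int_square) simp_all
  moreover have "{p \<in> UNIV \<times> UNIV. (case p of (x :: int, y) \<Rightarrow> 1 * nat (x\<^sup>2) + 3 * nat (y\<^sup>2)) = n} =
      {(x, y). x\<^sup>2 + 3 * y\<^sup>2 = int n}"
  proof -
    have "1 * nat (x\<^sup>2) + 3 * nat (y\<^sup>2) = n \<longleftrightarrow> x\<^sup>2 + 3 * y\<^sup>2 = int n" for x y :: int
    proof -
      have "int (1 * nat (x\<^sup>2) + 3 * nat (y\<^sup>2)) = x\<^sup>2 + 3 * y\<^sup>2" by simp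
      then show ?thesis by (metis of_nat_eq_iff)
    qed
    then show ?thesis by auto
  qed
  ultimately have L: "fps_nth ((1 + 2 * theta_sq 1) * (1 + 2 * theta_sq 3)) n =
      int (card {(x :: int, y). x\<^sup>2 + 3 * y\<^sup>2 = int n})"
    by (simp only: gf_nth)
  have "theta_tri 2 * theta_tri 6 = gf (\<lambda>(s, t). 2 * (s * Suc s div 2) + 6 * (t * Suc t div 2)) (UNIV \<times> UNIV)"
    unfolding theta_tri_def by (intro gf_mult finite_fibre_nat le_mult_triangle) simp_all
  also have "(\<lambda>(s, t). 2 * (s * Suc s div 2) + 6 * (t * Suc t div 2)) = (\<lambda>(s, t). s * Suc s + 3 * (t * Suc t))"
  proof -
    have "6 * k = 3 * (2 * k)" for k :: nat by simp
    moreover have "2 * (t * Suc t div 2) = t * Suc t" for t by simp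
    ultimately show ?thesis by (simp only:)
  qed
  finally have "fps_X ^ 1 * (theta_tri 2 * theta_tri 6) =
      gf (\<lambda>p. (case p of (s, t) \<Rightarrow> s * Suc s + 3 * (t * Suc t)) + 1) (UNIV \<times> UNIV)"
    by (simp only: gf_shift)
  moreover have "{p \<in> UNIV \<times> UNIV. (case p of (s, t) \<Rightarrow> s * Suc s + 3 * (t * Suc t)) + 1 = n} =
      {(s, t). s * Suc s + 3 * (t * Suc t) + 1 = n}"
    by auto
  ultimately have "fps_nth (fps_X ^ 1 * (theta_tri 2 * theta_tri 6)) n =
      int (card {(s, t). s * Suc s + 3 * (t * Suc t) + 1 = n})"
    by (simp only: gf_nth)
  moreover have "fps_nth (2 * (fps_X * (theta_tri 2 * theta_tri 6))) n =
      2 * fps_nth (fps_X * (theta_tri 2 * theta_tri 6)) n"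
    by (simp only: mult_2 fps_add_nth)
  ultimately show ?thesis
    by (simp only: L card_square_plus_three_square[OF assms] power_one_right of_nat_mult of_nat_numeral)
qed

text \<open>Off-diagonal pairs cancel modulo 2 under swapping, and the diagonal doubles the
  exponents. The linear order selects one pair from each swapped couple.\<close>

lemma gf_square_mod_2:
  fixes A :: "'a::linorder set"
  assumes fin: "\<And>k. finite {x \<in> A. a x = k}"
  shows "rcong 2 ((gf a A)\<^sup>2) (gf (\<lambda>x. 2 * a x) A)"
proof -
  let ?b = "\<lambda>(x, y). a x + a y"
  define U where "U = {p \<in> A \<times> A. fst p < snd p}"
  define L where "L = {p \<in> A \<times> A. snd p < fst p}"
  define E where "E = {p \<in> A \<times> A. fst p = snd p}"
  have fin2: "finite {p \<in> B. ?b p = k}" if "B \<subseteq> A \<times> A" for B k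
  proof (rule finite_subset)
    show "{p \<in> B. ?b p = k} \<subseteq> (\<Union>i\<in>{..k}. {x \<in> A. a x = i}) \<times> (\<Union>i\<in>{..k}. {x \<in> A. a x = i})"
      using that by auto
  qed (use fin in auto)
  have "(gf a A)\<^sup>2 = gf ?b (A \<times> A)"
    unfolding power2_eq_square by (intro gf_mult fin)
  also have "A \<times> A = E \<union> (U \<union> L)"
    unfolding E_def U_def L_def by auto
  also have "gf ?b (E \<union> (U \<union> L)) = gf ?b E + gf ?b (U \<union> L)"
    by (intro gf_Un fin2) (auto simp: E_def U_def L_def)
  also have "gf ?b (U \<union> L) = gf ?b U + gf ?b L"
    by (intro gf_Un fin2) (auto simp: E_def U_def L_def)
  also have "gf ?b L = gf ?b U"
  proof (rule gf_reindex)
    show "bij_betw prod.swap U L"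
      by (rule bij_betw_byWitness[of _ prod.swap]) (auto simp: U_def L_def)
  qed auto
  also have "gf ?b E = gf (\<lambda>x. 2 * a x) A"
  proof (rule gf_reindex)
    show "bij_betw (\<lambda>x. (x, x)) A E"
      by (rule bij_betw_byWitness[of _ fst]) (auto simp: E_def)
  qed auto
  finally show ?thesis
    by (simp add: rcong_def)
qed

lemma theta_sq_square_mod_2:
  assumes "m \<ge> 1"
  shows "rcong 2 ((theta_sq m)\<^sup>2) (theta_sq (2 * m))"
  unfolding theta_sq_def mult.assoc
  by (rule gf_square_mod_2[OF finite_fibre_nat[OF le_mult_square[OF assms]]])

lemma theta_tri_square_mod_2:
  assumes "m \<ge> 1"
  shows "rcong 2 ((theta_tri m)\<^sup>2) (theta_tri (2 * m))"
  unfolding theta_tri_def mult.assoc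
  by (rule gf_square_mod_2[OF finite_fibre_nat[OF le_mult_triangle[OF assms]]])

section \<open>Series supported on a residue class\<close>

definition supported :: "nat \<Rightarrow> nat \<Rightarrow> 'a::zero fps \<Rightarrow> bool" where
  "supported d r f \<longleftrightarrow> (\<forall>n. fps_nth f n \<noteq> 0 \<longrightarrow> [n = r] (mod d))"

lemma supported_mod: "supported d r f \<Longrightarrow> [r = s] (mod e) \<Longrightarrow> e dvd d \<Longrightarrow> supported e s f"
  unfolding supported_def by (meson cong_dvd_modulus_nat cong_trans)

lemma supported_add: "supported d r f \<Longrightarrow> supported d r g \<Longrightarrow> supported d r (f + g)"
  for f g :: "'a::comm_ring_1 fps"
  unfolding supported_def fps_add_nth by (metis add_0)

lemma supported_diff: "supported d r f \<Longrightarrow> supported d r g \<Longrightarrow> supported d r (f - g)"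
  for f g :: "'a::comm_ring_1 fps"
  unfolding supported_def fps_sub_nth by (metis diff_zero)

lemma supported_mult:
  fixes f g :: "'a::comm_ring_1 fps"
  assumes "supported d r f" "supported d s g"
  shows "supported d (r + s) (f * g)"
  unfolding supported_def
proof (intro allI impI)
  fix n assume "fps_nth (f * g) n \<noteq> 0"
  then obtain i where i: "i \<le> n" "fps_nth f i * fps_nth g (n - i) \<noteq> 0"
    unfolding fps_mult_nth by (metis (no_types, lifting) atLeastAtMost_iff sum.neutral)
  have "fps_nth f i \<noteq> 0" "fps_nth g (n - i) \<noteq> 0"
    using i(2) by auto
  then have "[i = r] (mod d)" "[n - i = s] (mod d)"
    using assms unfolding supported_def by blast+
  then have "[i + (n - i) = r + s] (mod d)" by (rule cong_add)
  with i(1) show "[n = r + s] (mod d)" by simp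
qed

lemma supported_mult_0: "supported d 0 f \<Longrightarrow> supported d r g \<Longrightarrow> supported d r (f * g)"
  for f g :: "'a::comm_ring_1 fps"
  using supported_mult[of d 0 f r g] by simp

lemma supported_const: "supported d 0 (fps_const c)"
  by (auto simp: supported_def)

lemma supported_one: "supported d 0 (1 :: 'a::comm_ring_1 fps)"
  using supported_const[of d "1 :: 'a"] by simp

lemma supported_numeral: "supported d 0 (numeral c :: 'a::comm_ring_1 fps)"
  using supported_const[of d "numeral c :: 'a"] by (simp add: fps_numeral_fps_const)

lemma supported_power: "supported d 0 f \<Longrightarrow> supported d 0 (f ^ n)"
  for f :: "'a::comm_ring_1 fps"
  by (induction n) (simp_all add: supported_one supported_mult_0)

lemma supported_X_power: "supported d k (fps_X ^ k :: 'a::comm_ring_1 fps)"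
  by (auto simp: supported_def fps_X_power_nth)

lemma supported_gf:
  assumes "\<And>x. x \<in> A \<Longrightarrow> d dvd a x"
  shows "supported d 0 (gf a A)"
  unfolding supported_def
proof (intro allI impI)
  fix n assume "fps_nth (gf a A) n \<noteq> 0"
  then have "card {x \<in> A. a x = n} \<noteq> 0" by (simp add: gf_nth)
  then obtain x where "x \<in> A" "a x = n" by (metis (mono_tags, lifting) card.empty empty_Collect_eq)
  with assms[of x] show "[n = 0] (mod d)" by (simp add: cong_0_iff)
qed

lemma supported_theta_sq: "d dvd m \<Longrightarrow> supported d 0 (theta_sq m)"
  unfolding theta_sq_def by (rule supported_gf) simp

lemma supported_theta_tri: "d dvd m \<Longrightarrow> supported d 0 (theta_tri m)"
  unfolding theta_tri_def by (rule supported_gf) simp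

text \<open>The part of an inverse off the multiples of \<open>d\<close> is annihilated by a non-zero series.\<close>
lemma supported_inverse:
  fixes f g :: "'a::idom fps"
  assumes "supported d 0 f" "f * g = 1"
  shows "supported d 0 g"
proof -
  define h where "h = Abs_fps (\<lambda>n. if d dvd n then fps_nth g n else 0)"
  have h: "supported d 0 h"
    by (auto simp: h_def supported_def cong_0_iff)
  have "fps_nth (f * (g - h)) n = 0" for n
  proof (cases "d dvd n")
    case True
    have "fps_nth f i * fps_nth (g - h) (n - i) = 0" if "i \<in> {0..n}" for i
    proof (cases "d dvd i")
      case True
      with \<open>d dvd n\<close> that have "d dvd n - i" by simp
      then show ?thesis by (simp add: h_def)
    next
      case False
      then show ?thesis using assms(1) by (auto simp: supported_def cong_0_iff)
    qed
    then show ?thesis unfolding fps_mult_nth by (intro sum.neutral ballI)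
  next
    case False
    then have "fps_nth (f * h) n = 0"
      using supported_mult_0[OF assms(1) h] by (auto simp: supported_def cong_0_iff)
    moreover have "fps_nth (f * g) n = 0"
      using False by (cases "n = 0") (simp_all add: assms(2))
    ultimately show ?thesis by (simp add: right_diff_distrib)
  qed
  then have "f * (g - h) = 0" by (intro fps_ext) simp
  moreover have "f \<noteq> 0" using assms(2) by auto
  ultimately show ?thesis using h by simp
qed

lemma supported_qf:
  assumes "m \<ge> 1" "d dvd m"
  shows "supported d 0 (qf m)"
  unfolding supported_def
proof (intro allI impI)
  fix n assume "fps_nth (qf m) n \<noteq> 0"
  have P: "supported d 0 (\<Prod>k\<in>{0<..N}. 1 - (fps_X ^ m) ^ k :: int fps)" for N
  proof -
    have "supported d 0 (fps_X ^ m :: int fps)"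
      using assms(2) by (intro supported_mod[OF supported_X_power, of m 0 d]) (simp_all add: cong_0_iff)
    then have "supported d 0 (1 - (fps_X ^ m) ^ k :: int fps)" for k
      by (rule supported_diff[OF supported_one supported_power])
    moreover have "{0<..Suc N} = insert (Suc N) {0<..N}" for N by auto
    ultimately show ?thesis
      by (induction N) (simp_all add: supported_one supported_mult_0 del: power_Suc)
  qed
  \<comment> \<open>Truncation modulo \<open>fps_X ^ Suc n\<close> is what determines the
    coefficient at \<open>n\<close>.\<close>
  have "fps_nth (qf m) n = fps_nth (\<Prod>k\<in>{0<..Suc n}. 1 - (fps_X ^ m) ^ k) n"
    using qf_truncate[OF assms(1) order_refl, of "Suc n"]
    unfolding rcong_def fps_X_power_dvd_iff by auto
  with \<open>fps_nth (qf m) n \<noteq> 0\<close> show "[n = 0] (mod d)"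
    using P unfolding supported_def by metis
qed

lemma fps_numeral_mult_nth: "fps_nth (numeral c * f) n = numeral c * fps_nth f n"
  for f :: "'a::comm_ring_1 fps"
  by (simp add: numeral_fps_const)

lemma fps_dvd_one: "fps_nth f 0 = 1 \<Longrightarrow> f dvd 1" for f :: "int fps"
  by (metis dvd_triv_left fps_right_inverse mult_1)

lemma numeral_dvd_fpsI:
  fixes f :: "'a::comm_ring_1 fps"
  assumes "\<And>n. numeral c dvd fps_nth f n"
  shows "numeral c dvd f"
proof -
  have "\<exists>g. \<forall>n. fps_nth f n = numeral c * g n"
    using assms by (intro choice) (auto elim: dvdE)
  then obtain g where "\<And>n. fps_nth f n = numeral c * g n" by blast
  then have "f = numeral c * Abs_fps g"
    by (intro fps_ext) (simp add: fps_numeral_mult_nth)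
  then show ?thesis by (rule dvdI)
qed

lemma rcong_numeral_nth:
  fixes f g :: "'a::comm_ring_1 fps"
  assumes "rcong (numeral c) f g"
  shows "numeral c dvd fps_nth f n - fps_nth g n"
  using assms unfolding rcong_def
  by (metis dvd_def fps_numeral_mult_nth fps_sub_nth)

lemma supported_nth_eq_0: "supported d r f \<Longrightarrow> \<not> [n = r] (mod d) \<Longrightarrow> fps_nth f n = 0"
  by (auto simp: supported_def)

section \<open>Reduction modulo powers of two\<close>

text \<open>In classical notation \<open>phi_alt m\<close> is \<phi>(-q^m), and \<open>phi m\<close>
  below is \<phi>(q^m).\<close>

abbreviation phi_alt :: "nat \<Rightarrow> int fps" where
  "phi_alt m \<equiv> 1 + 2 * theta_alt m"

abbreviation phi :: "nat \<Rightarrow> int fps" where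
  "phi m \<equiv> 1 + 2 * theta_sq m"

lemma theta_alt_mod_2:
  assumes "m \<ge> 1"
  shows "rcong 2 (theta_alt m) (theta_sq m)"
  unfolding theta_sq_dissection[OF assms] theta_alt_def by (simp add: rcong_def)

lemma theta_alt_add_square_mod_2:
  assumes "m \<ge> 1"
  shows "rcong 2 (theta_alt m + (theta_alt m)\<^sup>2) (theta_sq m + theta_sq (2 * m))"
  by (intro rcong_add theta_alt_mod_2 assms
      rcong_trans[OF rcong_power[OF theta_alt_mod_2] theta_sq_square_mod_2])

text \<open>(1 + 2t)^2 = 1 + 4(t + t^2), so t + t^2 matters only modulo 2, where signs disappear and
  squaring doubles exponents.\<close>

lemma phi_alt_square_mod_8:
  assumes "m \<ge> 1"
  shows "rcong 8 ((phi_alt m)\<^sup>2) (1 + 4 * (theta_sq m + theta_sq (2 * m)))"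
proof -
  have "(phi_alt m)\<^sup>2 = 1 + 4 * (theta_alt m + (theta_alt m)\<^sup>2)"
    by (simp add: power2_eq_square algebra_simps)
  moreover have "rcong (4 * 2) (4 * (theta_alt m + (theta_alt m)\<^sup>2)) (4 * (theta_sq m + theta_sq (2 * m)))"
    by (intro rcong_scale theta_alt_add_square_mod_2 assms)
  ultimately show ?thesis
    by (simp only:) (intro rcong_add rcong_refl, simp)
qed

lemma phi_alt_pow4_mod_16:
  assumes "m \<ge> 1"
  shows "rcong 16 (phi_alt m ^ 4) (1 + 8 * (theta_sq m + theta_sq (2 * m)))"
proof -
  define u where "u = theta_alt m + (theta_alt m)\<^sup>2"
  have "(phi_alt m)\<^sup>2 = 1 + 4 * u"
    by (simp add: u_def power2_eq_square algebra_simps)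
  then have "phi_alt m ^ 4 = (1 + 4 * u)\<^sup>2"
    by (metis power_mult num_double numeral_times_numeral)
  also have "\<dots> = 1 + 8 * u + 16 * u\<^sup>2"
    by (simp add: power2_eq_square algebra_simps)
  also have "rcong 16 \<dots> (1 + 8 * u)"
    by (simp add: rcong_def)
  also have "rcong (8 * 2) (8 * u) (8 * (theta_sq m + theta_sq (2 * m)))"
    unfolding u_def by (intro rcong_scale theta_alt_add_square_mod_2 assms)
  then have "rcong 16 (1 + 8 * u) (1 + 8 * (theta_sq m + theta_sq (2 * m)))"
    by (intro rcong_add rcong_refl) simp
  finally show ?thesis .
qed

lemma phi_alt_pow4_mod_8:
  assumes "m \<ge> 1"
  shows "rcong 8 (phi_alt m ^ 4) 1"
proof -
  have "rcong 8 (phi_alt m ^ 4) (1 + 8 * (theta_sq m + theta_sq (2 * m)))"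
    by (rule rcong_modulus[OF phi_alt_pow4_mod_16[OF assms]]) (simp add: dvd_def exI[of _ 2])
  also have "rcong 8 \<dots> 1" by (simp add: rcong_def)
  finally show ?thesis .
qed

text \<open>The even squares enter both factors with the same sign and the odd squares with opposite
  signs, so the product is a difference of squares.\<close>

lemma phi_alt_mult_phi:
  assumes "m \<ge> 1"
  shows "phi_alt m * phi m = (1 + 2 * theta_sq (4 * m))\<^sup>2 - 4 * (fps_X ^ m * theta_tri (8 * m))\<^sup>2"
  unfolding theta_sq_dissection[OF assms] theta_alt_def
  by (simp add: power2_eq_square algebra_simps)

lemma supported_phi_alt_mult_phi:
  assumes "m \<ge> 1"
  shows "supported 2 0 (phi_alt m * phi m)"
proof -
  have "supported 2 0 ((fps_X ^ m)\<^sup>2 :: int fps)"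
    unfolding power_mult[symmetric]
    by (rule supported_mod[OF supported_X_power[of 2]]) (simp_all add: cong_0_iff)
  then show ?thesis
    unfolding phi_alt_mult_phi[OF assms] power_mult_distrib
    by (intro supported_diff supported_mult_0 supported_power[of _ "1 + _"] supported_power[of _ "theta_tri _"]
        supported_add supported_one supported_numeral supported_theta_sq supported_theta_tri) simp_all
qed

text \<open>This is \<phi>(q)\<phi>(-q) = \<phi>(-q^2)^2 read modulo 8. After the difference of
  squares is expanded, a^2 - b^2 agrees with (a + b)^2 modulo 2.\<close>

lemma phi_alt_mult_phi_mod_8:
  assumes "m \<ge> 1"
  shows "rcong 8 (phi_alt m * phi m) ((phi_alt (2 * m))\<^sup>2)"
proof -
  define a where "a = theta_sq (4 * m)"
  define b where "b = fps_X ^ m * theta_tri (8 * m)"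
  have "rcong 2 (a\<^sup>2 - b\<^sup>2) ((theta_sq m)\<^sup>2)"
    unfolding theta_sq_dissection[OF assms] a_def[symmetric] b_def[symmetric]
  proof -
    have "(a\<^sup>2 - b\<^sup>2) - (b + a)\<^sup>2 = 2 * (- (b\<^sup>2) - a * b)" by (simp add: power2_eq_square algebra_simps)
    then show "rcong 2 (a\<^sup>2 - b\<^sup>2) ((b + a)\<^sup>2)" unfolding rcong_def by (rule dvdI)
  qed
  also have "rcong 2 \<dots> (theta_sq (2 * m))" by (rule theta_sq_square_mod_2[OF assms])
  finally have "rcong 2 (a + (a\<^sup>2 - b\<^sup>2)) (a + theta_sq (2 * m))"
    by (intro rcong_add rcong_refl)
  then have "rcong (4 * 2) (4 * (a + (a\<^sup>2 - b\<^sup>2))) (4 * (a + theta_sq (2 * m)))"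
    by (rule rcong_scale)
  then have *: "rcong 8 (1 + 4 * (a + (a\<^sup>2 - b\<^sup>2))) (1 + 4 * (a + theta_sq (2 * m)))"
    by (intro rcong_add rcong_refl) simp
  have "phi_alt m * phi m = 1 + 4 * (a + (a\<^sup>2 - b\<^sup>2))"
    unfolding phi_alt_mult_phi[OF assms] a_def[symmetric] b_def[symmetric]
    by (simp add: power2_eq_square algebra_simps)
  also note *
  also have "rcong 8 ((phi_alt (2 * m))\<^sup>2) (1 + 4 * (a + theta_sq (2 * m)))"
    using phi_alt_square_mod_8[of "2 * m"] assms by (simp add: a_def add.commute)
  note rcong_sym[OF this]
  finally show ?thesis .
qed

lemma qf_square_mod_2:
  assumes "m \<ge> 1"
  shows "rcong 2 ((qf m)\<^sup>2) (qf (2 * m))"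
  unfolding gauss_square[OF assms, symmetric] by (simp add: rcong_def algebra_simps)

lemma qf_dvd_one: "m \<ge> 1 \<Longrightarrow> qf m dvd 1"
  by (intro fps_dvd_one qf_has_prod(2))

text \<open>Modulo 2, f_(2m)^2 / f_m becomes f_m^4 / f_m.\<close>

lemma theta_tri_mod_2:
  assumes "m \<ge> 1"
  shows "rcong 2 (theta_tri m) (qf m ^ 3)"
proof (rule rcong_cancel[OF _ qf_dvd_one[OF assms]])
  have "qf m * theta_tri m = (qf (2 * m))\<^sup>2"
    using gauss_triangular[OF assms] by (simp add: mult.commute)
  also have "rcong 2 \<dots> (((qf m)\<^sup>2)\<^sup>2)"
    by (intro rcong_power rcong_sym[OF qf_square_mod_2] assms)
  also have "((qf m)\<^sup>2)\<^sup>2 = qf m * qf m ^ 3"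
    by (simp add: eval_nat_numeral)
  finally show "rcong 2 (qf m * theta_tri m) (qf m * qf m ^ 3)" .
qed

lemma theta_tri_nth_0:
  assumes "m \<ge> 1"
  shows "fps_nth (theta_tri m) 0 = 1"
proof -
  have "fps_nth (theta_tri m * qf m) 0 = fps_nth ((qf (2 * m))\<^sup>2) 0"
    by (simp only: gauss_triangular[OF assms])
  then show ?thesis
    using assms by (simp add: qf_has_prod(2) fps_nth_power_0)
qed

lemma phi_alt_dvd_one:
  assumes "m \<ge> 1"
  shows "phi_alt m dvd 1"
proof (rule fps_dvd_one)
  have "fps_nth (phi_alt m * qf (2 * m)) 0 = fps_nth ((qf m)\<^sup>2) 0"
    by (simp only: gauss_square[OF assms])
  then show "fps_nth (phi_alt m) 0 = 1"
    using assms by (simp only: fps_mult_nth_0 fps_nth_power_0) (simp add: qf_has_prod(2))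
qed

text \<open>This is the even part of \<phi>(q)\<phi>(q^3), obtained by subtracting the known odd
  part.\<close>

definition phi_even :: "int fps" where
  "phi_even = phi 1 * phi 3 - 2 * (fps_X * (theta_tri 2 * theta_tri 6))"

lemma supported_phi_even: "supported 2 0 phi_even"
  unfolding supported_def
proof (intro allI impI)
  fix n assume "fps_nth phi_even n \<noteq> 0"
  then have "even n"
    using theta_product_odd_nth[of n] unfolding phi_even_def fps_sub_nth by auto
  then show "[n = 0] (mod 2)" by (simp add: cong_0_iff)
qed

text \<open>The odd part of \<phi>(q)\<phi>(q^3) is computed twice: exactly as 2q
  \<psi>(q^2)\<psi>(q^6), and modulo 4 by expanding the product and dissecting each factor.
  Comparing the two and halving gives the congruence.\<close>

lemma theta_tri_2_6_mod_2:
  "rcong 2 (theta_tri 2 * theta_tri 6) (theta_tri 8 + fps_X\<^sup>2 * theta_tri 24)"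
proof -
  define H where "H = theta_tri 8 + fps_X\<^sup>2 * theta_tri 24 - theta_tri 2 * theta_tri 6"
  define w where "w = theta_sq 1 * theta_sq 3"
  have "theta_sq 1 = fps_X * theta_tri 8 + theta_sq 4"
    "theta_sq 3 = fps_X * (fps_X\<^sup>2 * theta_tri 24) + theta_sq 12"
    using theta_sq_dissection[of 1] theta_sq_dissection[of 3]
    by (simp_all add: power3_eq_cube power2_eq_square mult.assoc)
  then have "2 * (theta_sq 1 + theta_sq 3) =
      2 * (fps_X * (theta_tri 8 + fps_X\<^sup>2 * theta_tri 24)) + 2 * (theta_sq 4 + theta_sq 12)"
    by (simp add: algebra_simps)
  then have D: "phi_even = (1 + 2 * (theta_sq 4 + theta_sq 12)) + (4 * w + 2 * (fps_X * H))"
    unfolding phi_even_def H_def w_def by (simp add: algebra_simps)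
  have S: "supported 2 0 (1 + 2 * (theta_sq 4 + theta_sq 12))"
    by (intro supported_add supported_one supported_mult_0 supported_numeral supported_theta_sq) simp_all
  have "supported 2 0 H"
    unfolding H_def
    by (intro supported_add supported_diff supported_mult_0 supported_theta_tri
        supported_mod[OF supported_X_power[of 2]]) (simp_all add: cong_0_iff)
  have "2 dvd fps_nth H n" for n
  proof (cases "even n")
    case True
    then have "\<not> [Suc n = 0] (mod 2)" by (simp add: cong_0_iff)
    then have "fps_nth phi_even (Suc n) = 0" "fps_nth (1 + 2 * (theta_sq 4 + theta_sq 12)) (Suc n) = 0"
      by (rule supported_nth_eq_0[OF supported_phi_even], rule supported_nth_eq_0[OF S])
    with D have "fps_nth (4 * w + 2 * (fps_X * H)) (Suc n) = 0"
      by (metis add_0 fps_add_nth)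
    \<comment> \<open>At the odd exponent \<open>Suc n\<close> both even series vanish, so the
      coefficient of \<open>H\<close> at \<open>n\<close> is even.\<close>
    then have "4 * fps_nth w (Suc n) + 2 * fps_nth H n = 0"
      by (simp add: fps_numeral_mult_nth)
    then show ?thesis by presburger
  next
    case False
    then have "fps_nth H n = 0"
      using supported_nth_eq_0[OF \<open>supported 2 0 H\<close>] by (simp add: cong_0_iff)
    then show ?thesis by simp
  qed
  then have "2 dvd H" by (rule numeral_dvd_fpsI)
  then show ?thesis
    unfolding H_def by (intro rcong_sym[of 2 "theta_tri 8 + _"]) (simp add: rcong_def)
qed

lemma theta_tri_4_12_mod_2:
  "rcong 2 (theta_tri 4 * theta_tri 12) (theta_tri 16 + fps_X ^ 4 * theta_tri 48)"
proof -
  have "rcong 2 (theta_tri 4 * theta_tri 12) ((theta_tri 2)\<^sup>2 * (theta_tri 6)\<^sup>2)"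
    using rcong_sym[OF theta_tri_square_mod_2[of 2]] rcong_sym[OF theta_tri_square_mod_2[of 6]]
    by (intro rcong_mult) simp_all
  also have "\<dots> = (theta_tri 2 * theta_tri 6)\<^sup>2"
    by (simp add: power_mult_distrib)
  also have "rcong 2 \<dots> ((theta_tri 8 + fps_X\<^sup>2 * theta_tri 24)\<^sup>2)"
    by (intro rcong_power theta_tri_2_6_mod_2)
  also have "(theta_tri 8 + fps_X\<^sup>2 * theta_tri 24)\<^sup>2 =
     ((theta_tri 8)\<^sup>2 + fps_X ^ 4 * (theta_tri 24)\<^sup>2) + 2 * (fps_X\<^sup>2 * theta_tri 8 * theta_tri 24)"
    by (simp add: power2_eq_square eval_nat_numeral algebra_simps)
  also have "rcong 2 \<dots> ((theta_tri 8)\<^sup>2 + fps_X ^ 4 * (theta_tri 24)\<^sup>2)"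
    by (simp add: rcong_def)
  also have "rcong 2 \<dots> (theta_tri 16 + fps_X ^ 4 * theta_tri 48)"
    using theta_tri_square_mod_2[of 8] theta_tri_square_mod_2[of 24]
    by (intro rcong_mult rcong_add rcong_refl) simp_all
  finally show ?thesis .
qed

lemma phi_mod_2: "rcong 2 (phi m) 1"
  by (simp add: rcong_def)

lemma phi_alt_mod_2: "rcong 2 (phi_alt m) 1"
  by (simp add: rcong_def)

lemma rcong_mult_one: "rcong m a 1 \<Longrightarrow> rcong m b 1 \<Longrightarrow> rcong m (a * b) 1"
  using rcong_mult[of m a 1 b 1] by simp

section \<open>The even cofactor \<open>K\<close>, characterised by a product equation instead of a
  quotient\<close>

context
  fixes K :: "int fps"
  assumes K: "K * (qf 2 ^ 3 * (phi_alt 1 * phi 1) * (phi_alt 3 * phi 3)) = qf 6 ^ 9"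
begin

text \<open>Gauss's identity for f_1^2 and f_3^2 turns the generating function into f_6^9
  \<phi>(-q^3)^3 / (f_2^3 \<phi>(-q)). Extending the fraction by \<phi>(q)\<phi>(q^3)\<phi>(-q^3)
  makes its denominator even.\<close>

lemma gf_factor: "Abs_fps CP3 = K * (phi 1 * phi 3) * phi_alt 3 ^ 4"
proof -
  define U where "U = qf 2 ^ 3 * (phi_alt 1 * phi 1) * (phi_alt 3 * phi 3)"
  define G where "G = Abs_fps CP3"
  define a p b r f g where "a = phi_alt 1" and "p = phi 1" and "b = phi_alt 3" and "r = phi 3"
    and "f = qf 2" and "g = qf 6"
  have f1: "(qf 1)\<^sup>2 = a * f" and f3: "(qf 3)\<^sup>2 = b * g"
    using gauss_square[of 1] gauss_square[of 3] by (simp_all add: a_def b_def f_def g_def)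
  have "qf 3 ^ 6 = (b * g) ^ 3"
    unfolding f3[symmetric] by (simp flip: power_mult)
  with CP3_gf_mult have main: "G * (a * f * f\<^sup>2) = (b * g) ^ 3 * g ^ 6"
    unfolding f1 by (simp add: G_def f_def g_def)
  have KU: "K * U = g ^ 9" using K by (simp add: U_def g_def)
  have "G * U = (G * (a * f * f\<^sup>2)) * (p * (b * r))"
    unfolding U_def a_def[symmetric] b_def[symmetric] p_def[symmetric] r_def[symmetric] f_def[symmetric]
    by (simp add: eval_nat_numeral mult_ac)
  also have "\<dots> = g ^ 9 * (p * r * b ^ 4)"
    unfolding main by (simp add: eval_nat_numeral mult_ac)
  also have "\<dots> = K * (p * r) * b ^ 4 * U"
    unfolding KU[symmetric] by (simp add: mult_ac)
  finally have "G * U = K * (p * r) * b ^ 4 * U" .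
  moreover have "fps_nth g 0 = 1" by (simp add: g_def qf_has_prod(2))
  then have "g ^ 9 \<noteq> 0" by auto
  then have "U \<noteq> 0" using KU by auto
  ultimately show ?thesis
    by (simp add: G_def p_def r_def b_def)
qed

text \<open>Gauss's identities give an exact formula for the left side times
  \<open>n2\<^sup>2 * e1 * e3\<close>. Modulo 8 that factor is \<open>n2 ^ 4 * n6\<^sup>2\<close>,
  hence \<open>n6\<^sup>2\<close>, which is a unit and cancels.\<close>

lemma K_theta_tri_mod_8:
  "rcong 8 (K * (theta_tri 2 * theta_tri 6)) ((phi_alt 6)\<^sup>2 * qf 12 ^ 6)"
proof -
  define s t e1 e3 n2 n6 where "s = theta_tri 2" and "t = theta_tri 6"
    and "e1 = phi_alt 1 * phi 1" and "e3 = phi_alt 3 * phi 3" and "n2 = phi_alt 2" and "n6 = phi_alt 6"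
  define f g h k where "f = qf 2" and "g = qf 6" and "h = qf 4" and "k = qf 12"
  have g: "s * f = h\<^sup>2" "t * g = k\<^sup>2" "f\<^sup>2 = n2 * h" "g\<^sup>2 = n6 * k"
    using gauss_triangular[of 2] gauss_triangular[of 6] gauss_square[of 2] gauss_square[of 6]
    by (simp_all add: s_def t_def n2_def n6_def f_def g_def h_def k_def)
  have KU: "K * (f ^ 3 * e1 * e3) = g ^ 9"
    using K by (simp add: f_def e1_def e3_def g_def)
  \<comment> \<open>The extra factor \<open>h\<^sup>2 * g\<close> clears denominators; it is
    non-zero and is cancelled below.\<close>
  have "(K * (s * t) * n2\<^sup>2 * e1 * e3) * (h\<^sup>2 * g) = (K * (f ^ 3 * e1 * e3)) * (s * f) * (t * g)"
  proof -
    have "n2\<^sup>2 * h\<^sup>2 = f ^ 3 * f"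
      unfolding power_mult_distrib[symmetric] g(3)[symmetric] by (simp add: eval_nat_numeral)
    then have "K * (s * t) * e1 * e3 * g * (n2\<^sup>2 * h\<^sup>2) = K * (s * t) * e1 * e3 * g * (f ^ 3 * f)"
      by simp
    then show ?thesis by (simp only: mult_ac)
  qed
  also have "\<dots> = g ^ 9 * h\<^sup>2 * k\<^sup>2"
    unfolding KU g(1,2) ..
  also have "g ^ 9 = g * (g\<^sup>2) ^ 4"
    by (simp flip: power_mult power_Suc)
  also have "g * (g\<^sup>2) ^ 4 * h\<^sup>2 * k\<^sup>2 = (n6 ^ 4 * k ^ 6) * (h\<^sup>2 * g)"
    unfolding g(4) by (simp add: eval_nat_numeral mult_ac)
  finally have "(K * (s * t) * n2\<^sup>2 * e1 * e3) * (h\<^sup>2 * g) = (n6 ^ 4 * k ^ 6) * (h\<^sup>2 * g)" .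
  moreover have "h \<noteq> 0" "g \<noteq> 0"
    using qf_has_prod(2)[of 4] qf_has_prod(2)[of 6] by (auto simp: h_def g_def)
  ultimately have exact: "K * (s * t) * n2\<^sup>2 * e1 * e3 = n6 ^ 4 * k ^ 6"
    by simp
  have e: "rcong 8 e1 (n2\<^sup>2)" "rcong 8 e3 (n6\<^sup>2)"
    using phi_alt_mult_phi_mod_8[of 1] phi_alt_mult_phi_mod_8[of 3]
    by (simp_all add: e1_def e3_def n2_def n6_def)
  have "n6\<^sup>2 * (K * (s * t)) = K * (s * t) * 1 * n6\<^sup>2" by (simp add: mult_ac)
  also have "rcong 8 \<dots> (K * (s * t) * n2 ^ 4 * n6\<^sup>2)"
    unfolding n2_def by (intro rcong_mult rcong_refl rcong_sym[OF phi_alt_pow4_mod_8]) simp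
  also have "K * (s * t) * n2 ^ 4 * n6\<^sup>2 = K * (s * t) * n2\<^sup>2 * n2\<^sup>2 * n6\<^sup>2"
    by (simp add: eval_nat_numeral mult_ac)
  also have "rcong 8 \<dots> (K * (s * t) * n2\<^sup>2 * e1 * e3)"
    by (intro rcong_mult rcong_refl rcong_sym[OF e(1)] rcong_sym[OF e(2)])
  also have "\<dots> = n6\<^sup>2 * (n6\<^sup>2 * k ^ 6)"
    unfolding exact by (simp add: eval_nat_numeral mult_ac)
  finally have "rcong 8 (n6\<^sup>2 * (K * (s * t))) (n6\<^sup>2 * (n6\<^sup>2 * k ^ 6))" .
  moreover have "n6\<^sup>2 dvd 1"
    using mult_dvd_mono[OF phi_alt_dvd_one phi_alt_dvd_one, of 6 6] by (simp add: n6_def power2_eq_square)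
  ultimately show ?thesis
    unfolding s_def t_def n6_def k_def by (rule rcong_cancel)
qed

text \<open>Modulo 2 all \<phi> factors are 1 and f^3 is \<psi>, so K \<psi>(q^2) is \<psi>(q^6)^3.
  Multiplying by \<psi>(q^2) produces \<psi>(q^4) on the left, and
  \<open>theta_tri_2_6_mod_2\<close> separates exponents modulo 4 on the right.\<close>

lemma K_mod_2:
  obtains L where "supported 4 0 L"
    and "rcong 2 K (theta_tri 16 + fps_X ^ 4 * theta_tri 48 + fps_X\<^sup>2 * L)"
proof -
  define t where "t = theta_tri 4"
  obtain i where i: "t * i = 1"
    using fps_dvd_one[OF theta_tri_nth_0[of 4]] unfolding t_def by (metis dvdE one_le_numeral)
  \<comment> \<open>\<open>L\<close> is the quotient \<psi>(q^24)\<psi>(q^12) / \<psi>(q^4), a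
    series in q^4.\<close>
  define L where "L = i * (theta_tri 24 * theta_tri 12)"
  have "supported 4 0 i"
    using supported_inverse[OF _ i] supported_theta_tri[of 4 4] by (simp add: t_def)
  then have L: "supported 4 0 L"
    unfolding L_def by (intro supported_mult_0 supported_theta_tri) simp_all
  have "K * theta_tri 2 = K * theta_tri 2 * 1" by simp
  also have "rcong 2 \<dots> (K * qf 2 ^ 3 * ((phi_alt 1 * phi 1) * (phi_alt 3 * phi 3)))"
    by (intro rcong_mult rcong_refl theta_tri_mod_2 rcong_sym[OF rcong_mult_one] rcong_mult_one
        phi_alt_mod_2 phi_mod_2) simp
  also have "\<dots> = qf 6 ^ 9" using K by (simp only: mult.assoc)
  also have "qf 6 ^ 9 = (qf 6 ^ 3) ^ 3" by (simp flip: power_mult)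
  also have "rcong 2 \<dots> (theta_tri 6 ^ 3)"
    by (intro rcong_power rcong_sym[OF theta_tri_mod_2]) simp
  finally have K2: "rcong 2 (K * theta_tri 2) (theta_tri 6 ^ 3)" .
  have "t * K = K * t" by (rule mult.commute)
  also have "rcong 2 \<dots> (K * (theta_tri 2)\<^sup>2)"
    using rcong_sym[OF theta_tri_square_mod_2[of 2]] unfolding t_def
    by (intro rcong_mult rcong_refl) simp
  also have "K * (theta_tri 2)\<^sup>2 = (K * theta_tri 2) * theta_tri 2"
    by (simp add: power2_eq_square mult.assoc)
  also have "rcong 2 \<dots> (theta_tri 6 ^ 3 * theta_tri 2)"
    by (intro rcong_mult rcong_refl K2)
  also have "theta_tri 6 ^ 3 * theta_tri 2 = theta_tri 2 * theta_tri 6 * (theta_tri 6)\<^sup>2"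
    by (simp add: eval_nat_numeral mult_ac)
  also have "rcong 2 \<dots> ((theta_tri 8 + fps_X\<^sup>2 * theta_tri 24) * theta_tri 12)"
    using theta_tri_square_mod_2[of 6] by (intro rcong_mult theta_tri_2_6_mod_2) simp
  also have "\<dots> = theta_tri 8 * theta_tri 12 + fps_X\<^sup>2 * (1 * (theta_tri 24 * theta_tri 12))"
    by (simp add: algebra_simps)
  also have "rcong 2 \<dots> (t\<^sup>2 * theta_tri 12 + fps_X\<^sup>2 * (1 * (theta_tri 24 * theta_tri 12)))"
    using rcong_sym[OF theta_tri_square_mod_2[of 4]] unfolding t_def
    by (intro rcong_add rcong_mult rcong_refl) simp
  also have "\<dots> = t * (t * theta_tri 12 + fps_X\<^sup>2 * L)"
    unfolding L_def i[symmetric] by (simp add: power2_eq_square algebra_simps)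
  finally have "rcong 2 (t * K) (t * (t * theta_tri 12 + fps_X\<^sup>2 * L))" .
  moreover have "t dvd 1" using i by (metis dvd_triv_left)
  ultimately have "rcong 2 K (t * theta_tri 12 + fps_X\<^sup>2 * L)" by (rule rcong_cancel)
  also have "rcong 2 \<dots> (theta_tri 16 + fps_X ^ 4 * theta_tri 48 + fps_X\<^sup>2 * L)"
    unfolding t_def by (intro rcong_add rcong_refl theta_tri_4_12_mod_2)
  finally show ?thesis using that L by blast
qed

end

text \<open>\<open>E\<close> and \<open>C\<close> collect everything with exponents that are even or
  congruent to 1 modulo 4, so exponents congruent to 3 see only the explicit term.\<close>

lemma CP3_gf_mod_16:
  obtains E C where "supported 2 0 E" "supported 4 1 C"
    and "rcong 16 (Abs_fps CP3) (E + C + 8 * (fps_X ^ 3 * (theta_tri 24 * theta_tri 16)))"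
proof -
  define U where "U = qf 2 ^ 3 * (phi_alt 1 * phi 1) * (phi_alt 3 * phi 3)"
  have phi_unit: "phi m dvd 1" if "m \<ge> 1" for m
    using that by (intro fps_dvd_one) (simp add: theta_sq_def gf_nth fps_numeral_mult_nth)
  have unit_mult: "a * b dvd 1" if "a dvd 1" "b dvd 1" for a b :: "int fps"
    using mult_dvd_mono[OF that] by simp
  have "U dvd 1"
    unfolding U_def power3_eq_cube
    by (intro unit_mult qf_dvd_one phi_alt_dvd_one phi_unit) simp_all
  then obtain i where i: "U * i = 1" by (metis dvdE)
  have U: "supported 2 0 U"
    unfolding U_def
    by (intro supported_mult_0 supported_power supported_qf supported_phi_alt_mult_phi) simp_all
  define K where "K = qf 6 ^ 9 * i"
  have K: "supported 2 0 K"
    unfolding K_def by (intro supported_mult_0 supported_power supported_qf supported_inverse[OF U i]) simp_all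
  have "K * U = qf 6 ^ 9 * (U * i)" unfolding K_def by (simp only: mult_ac)
  also have "\<dots> = qf 6 ^ 9" by (simp only: i mult_1_right)
  finally have KU: "K * (qf 2 ^ 3 * (phi_alt 1 * phi 1) * (phi_alt 3 * phi 3)) = qf 6 ^ 9"
    unfolding U_def .
  obtain L where L: "supported 4 0 L"
    and KL: "rcong 2 K (theta_tri 16 + fps_X ^ 4 * theta_tri 48 + fps_X\<^sup>2 * L)"
    using K_mod_2[OF KU] .
  define S where "S = theta_tri 2 * theta_tri 6"
  define x where "x = (fps_X :: int fps)"
  define f where "f = qf 12 ^ 6"
  define T24 T16 T48 where "T24 = theta_tri 24" and "T16 = theta_tri 16" and "T48 = theta_tri 48"
  define w12 w6 w24 where "w12 = theta_sq 12" and "w6 = theta_sq 6" and "w24 = theta_sq 24"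
  have phi: "phi 1 * phi 3 = phi_even + 2 * (x * S)"
    by (simp add: phi_even_def S_def x_def)
  have w3: "theta_sq 3 = x ^ 3 * T24 + w12" and w6: "w6 = x ^ 6 * T48 + w24"
    using theta_sq_dissection[of 3] theta_sq_dissection[of 6]
    by (simp_all add: x_def T24_def T48_def w12_def w6_def w24_def)
  have f: "rcong 2 f T24"
  proof -
    have "f = ((qf 12)\<^sup>2) ^ 3" by (simp add: f_def flip: power_mult)
    also have "rcong 2 \<dots> (qf 24 ^ 3)"
      using qf_square_mod_2[of 12] by (intro rcong_power) simp
    also have "rcong 2 \<dots> T24"
      unfolding T24_def by (intro rcong_sym[OF theta_tri_mod_2]) simp
    finally show ?thesis .
  qed
  define E where "E = K * phi_even + 8 * ((w12 + w6) * K)"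
  define C where "C = 2 * (x * (f * (1 + 4 * (w24 + w12)))) + 8 * (x ^ 5 * (T24 * L))"
  have "Abs_fps CP3 = K * (phi 1 * phi 3) * phi_alt 3 ^ 4"
    by (rule gf_factor[OF KU])
  also have "rcong 16 \<dots> (K * (phi 1 * phi 3) * (1 + 8 * (theta_sq 3 + w6)))"
    using phi_alt_pow4_mod_16[of 3] by (intro rcong_mult rcong_refl) (simp add: w6_def)
  also have "\<dots> = K * (phi 1 * phi 3) + 8 * ((theta_sq 3 + w6) * K * (phi 1 * phi 3))"
    by (simp add: algebra_simps)
  \<comment> \<open>Behind the factor 8, \<phi>(q)\<phi>(q^3) matters only modulo 2, where it is
    1.\<close>
  also have "rcong 16 \<dots> (K * (phi 1 * phi 3) + 8 * ((theta_sq 3 + w6) * K * 1))"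
  proof -
    have "rcong (8 * 2) (8 * ((theta_sq 3 + w6) * K * (phi 1 * phi 3))) (8 * ((theta_sq 3 + w6) * K * 1))"
      by (intro rcong_scale rcong_mult[OF rcong_refl] rcong_mult_one phi_mod_2)
    then show ?thesis by (intro rcong_add rcong_refl) simp
  qed
  also have "\<dots> = E + 2 * (x * (K * S)) + 8 * (x ^ 3 * T24 * K)"
    unfolding phi unfolding w3 E_def by (simp add: algebra_simps)
  also have "rcong 16 \<dots> (E + (2 * (x * (f * (1 + 4 * (w24 + w12)))) + 8 * (x ^ 7 * T48 * T24)) +
      8 * (x ^ 3 * T24 * (T16 + x ^ 4 * T48 + x\<^sup>2 * L)))"
  proof (intro rcong_add[OF rcong_add] rcong_refl)
    have "rcong 8 (K * S) ((phi_alt 6)\<^sup>2 * f)"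
      unfolding S_def f_def by (rule K_theta_tri_mod_8[OF KU])
    also have "rcong 8 \<dots> ((1 + 4 * (w6 + w12)) * f)"
      using phi_alt_square_mod_8[of 6] by (intro rcong_mult rcong_refl) (simp add: w6_def w12_def)
    also have "\<dots> = f * (1 + 4 * (w24 + w12)) + 4 * (x ^ 6 * T48 * f)"
      unfolding w6 by (simp add: algebra_simps)
    also have "rcong 8 \<dots> (f * (1 + 4 * (w24 + w12)) + 4 * (x ^ 6 * T48 * T24))"
    proof -
      have "rcong (4 * 2) (4 * (x ^ 6 * T48 * f)) (4 * (x ^ 6 * T48 * T24))"
        by (intro rcong_scale rcong_mult[OF rcong_refl] f)
      then show ?thesis by (intro rcong_add rcong_refl) simp
    qed
    \<comment> \<open>The prefactor \<open>2 * x\<close> lifts the congruence modulo 8 to one modulo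
      16.\<close>
    finally have "rcong (2 * x * 8) (2 * x * (K * S))
        (2 * x * (f * (1 + 4 * (w24 + w12)) + 4 * (x ^ 6 * T48 * T24)))"
      by (rule rcong_scale)
    then have "rcong 16 (2 * x * (K * S)) (2 * x * (f * (1 + 4 * (w24 + w12)) + 4 * (x ^ 6 * T48 * T24)))"
      by (rule rcong_modulus) simp
    moreover have "x ^ 7 = x * x ^ 6" by (simp flip: power_Suc)
    ultimately show "rcong 16 (2 * (x * (K * S)))
        (2 * (x * (f * (1 + 4 * (w24 + w12)))) + 8 * (x ^ 7 * T48 * T24))"
      by (simp add: algebra_simps)
    have "rcong (8 * 2) (8 * (x ^ 3 * T24 * K)) (8 * (x ^ 3 * T24 * (T16 + x ^ 4 * T48 + x\<^sup>2 * L)))"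
      unfolding x_def T16_def T48_def by (intro rcong_scale rcong_mult[OF rcong_refl] KL)
    then show "rcong 16 (8 * (x ^ 3 * T24 * K)) (8 * (x ^ 3 * T24 * (T16 + x ^ 4 * T48 + x\<^sup>2 * L)))"
      by simp
  qed
  \<comment> \<open>One copy of \<open>8 * x ^ 7 * T48 * T24\<close> comes from \<open>w6\<close> in
    \<open>K * S\<close>, the other from the \<open>x ^ 4 * T48\<close> term of \<open>K\<close>;
    together they vanish modulo 16.\<close>
  also have "\<dots> = (E + C + 8 * (x ^ 3 * (T24 * T16))) + 16 * (x ^ 7 * T48 * T24)"
    unfolding C_def by (simp add: eval_nat_numeral algebra_simps)
  also have "rcong 16 \<dots> (E + C + 8 * (x ^ 3 * (T24 * T16)))"
    by (simp add: rcong_def)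
  finally have main: "rcong 16 (Abs_fps CP3) (E + C + 8 * (fps_X ^ 3 * (theta_tri 24 * theta_tri 16)))"
    by (simp only: x_def T24_def T16_def)
  have "supported 2 0 E"
    unfolding E_def w12_def w6_def
    by (intro supported_add supported_mult_0 supported_numeral supported_theta_sq supported_phi_even K) simp_all
  moreover have "supported 4 1 C"
  proof -
    have X: "supported 4 1 (x ^ 1)" "supported 4 1 (x ^ 5)"
      unfolding x_def using supported_X_power[of 4 1]
        supported_mod[OF supported_X_power[of 4 5], where s = 1 and e = 4]
      by (simp_all add: cong_def)
    have f0: "supported 4 0 f"
      unfolding f_def by (intro supported_power supported_qf) simp_all
    have "supported 4 (1 + 0) (x ^ 1 * (f * (1 + 4 * (w24 + w12))))"
      unfolding w24_def w12_def
      by (intro supported_mult[OF X(1)] supported_mult_0[OF f0] supported_add supported_one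
          supported_mult_0[OF supported_numeral] supported_theta_sq) simp_all
    moreover have "supported 4 (1 + 0) (x ^ 5 * (T24 * L))"
      unfolding T24_def by (intro supported_mult[OF X(2)] supported_mult_0[OF _ L] supported_theta_tri) simp
    ultimately show ?thesis
      unfolding C_def by (intro supported_add supported_mult_0[OF supported_numeral]) simp_all
  qed
  ultimately show ?thesis using that main by blast
qed

theorem theorem3p2:
  shows "\<forall>n::nat. [CP3 (8 * n + 3) = 0] (mod 8) \<and> [CP3 (8 * n + 7) = 0] (mod 16)"
proof
  fix n :: nat
  obtain E C where E: "supported 2 0 E" and C: "supported 4 1 C"
    and G: "rcong 16 (Abs_fps CP3) (E + C + 8 * (fps_X ^ 3 * (theta_tri 24 * theta_tri 16)))"
    by (rule CP3_gf_mod_16)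
  define T where "T = fps_X ^ 3 * (theta_tri 24 * theta_tri 16)"
  have "supported 8 (3 + 0) T"
    unfolding T_def by (intro supported_mult supported_X_power supported_mult_0 supported_theta_tri) simp_all
  then have T: "supported 8 3 T" by simp
  \<comment> \<open>Exponents congruent to 3 modulo 4 miss \<open>E\<close> and \<open>C\<close>.
    The remaining \<open>8 * fps_nth T k\<close> gives divisibility by 8 in general and by 16 where
    \<open>T\<close> vanishes, as it does at \<open>8 * n + 7\<close>.\<close>
  have key: "16 dvd CP3 k - 8 * fps_nth T k" if "k mod 4 = 3" for k
  proof -
    have "k mod 2 = 1" using that by presburger
    then have "fps_nth E k = 0" "fps_nth C k = 0"
      using that by (auto intro!: supported_nth_eq_0[OF E] supported_nth_eq_0[OF C] simp: cong_def)
    with rcong_numeral_nth[OF G, of k] show ?thesis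
      by (simp add: T_def fps_numeral_mult_nth)
  qed
  have "(8 * n + 3) mod 4 = 3" "(8 * n + 7) mod 4 = 3" by presburger+
  note key[OF this(1)] key[OF this(2)]
  moreover have "fps_nth T (8 * n + 7) = 0"
    by (rule supported_nth_eq_0[OF T]) (simp add: cong_def)
  ultimately show "[CP3 (8 * n + 3) = 0] (mod 8) \<and> [CP3 (8 * n + 7) = 0] (mod 16)"
    unfolding cong_0_iff by presburger
qed

end
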